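(* Let $p\in[2,\infty)$. Then for all $w\in\mathbb{R}$, $$\mathbb{I}^{\mathsf{an}}_p(w)=\inf_{\nu\in\mathcal{P}(\mathbb{R}):\ m_2(\nu)\le1}\left\{\mathbb{I}^{\mathsf{qu}}_{p,\nu}(w)+H(\nu|\mu_2)+\tfrac12\bigl(1-m_2(\nu)\bigr)\right\}.$$ In particular, $\mathbb{I}^{\mathsf{an}}_p(w)\le\mathbb{I}^{\mathsf{qu}}_{p,\mu_2}(w)$ for all $w\in\mathbb{R}$.
   Context: $\mathcal{P}(\mathbb{R})$ is the set of Borel probability measures on $\mathbb{R}$; $m_q(\nu)=\int|x|^q\nu(dx)$; $H(\nu|\mu)=\int\log\frac{d\nu}{d\mu}\,d\nu$ if $\nu\ll\mu$ and $+\infty$ otherwise. $\mu_p$ is the probability measure on $\mathbb{R}$ with density $f_p(y)=\frac{1}{2p^{1/p}\Gamma(1+1/p)}e^{-|y|^p/p}$; $\mu_2$ is standard Gaussian. The Legendre transform is $\Lambda^*(\tau)=\sup_t\{\langle t,\tau\rangle-\Lambda(t)\}$. Annealed rate function: $\Phi_p(t_0,t_1,t_2)=\log\int_{\mathbb{R}}\int_{\mathbb{R}}e^{t_0z^2+t_1zy+t_2|y|^p}\mu_2(dz)\mu_p(dy)$, $t_0,t_1,t_2\in\mathbb{R}$, and $$\mathbb{I}^{\mathsf{an}}_p(w)=\inf\{\Phi_p^*(\tau_0,\tau_1,\tau_2):\tau_0>0,\tau_1\in\mathbb{R},\tau_2>0,\ \tau_0^{-1/2}\tau_1\tau_2^{-1/p}=w\}.$$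 Quenched rate functions: $\Lambda_p(t_1,t_2)=\log\int_{\mathbb{R}}e^{t_1y+t_2|y|^p}\mu_p(dy)$, $\Psi_{p,\nu}(t_1,t_2)=\int_{\mathbb{R}}\Lambda_p(t_1u,t_2)\nu(du)$, $t_1,t_2\in\mathbb{R}$, and $$\mathbb{I}^{\mathsf{qu}}_{p,\nu}(w)=\inf\{\Psi^*_{p,\nu}(\tau_1,\tau_2):\tau_1\in\mathbb{R},\tau_2>0,\ \tau_1\tau_2^{-1/p}=w\}.$$ *)

theory Defs
  imports "HOL-Probability.Probability"
begin

definition ln_ennreal :: "ennreal \<Rightarrow> ereal" where
  "ln_ennreal x =
     (if x = 0 then - \<infinity> else if x = \<infinity> then \<infinity> else ereal (ln (enn2real x)))"

(* Integral of an extended-real function as positive part minus negative part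
   (e2ennreal truncates negative arguments to 0). Unlike the Bochner integral it keeps
   the value +infinity. The indeterminate case infinity - infinity does not arise
   below: the negative part of log(d nu/d mu) is nu-integrable, and
   Lambda_p (t1 * u, t2) is bounded below in u by Lambda_p (0, t2) > -infinity. *)
definition ereal_integral :: "'a measure \<Rightarrow> ('a \<Rightarrow> ereal) \<Rightarrow> ereal" where
  "ereal_integral M f =
     enn2ereal (\<integral>\<^sup>+ x. e2ennreal (f x) \<partial>M) - enn2ereal (\<integral>\<^sup>+ x. e2ennreal (- f x) \<partial>M)"

definition legendre :: "('a::real_inner \<Rightarrow> ereal) \<Rightarrow> 'a \<Rightarrow> ereal" where
  "legendre \<Lambda> \<tau> = (SUP t. ereal (t \<bullet> \<tau>) - \<Lambda> t)"

definition moment :: "real \<Rightarrow> real measure \<Rightarrow> ennreal" where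
  "moment q \<nu> = (\<integral>\<^sup>+ x. ennreal (\<bar>x\<bar> powr q) \<partial>\<nu>)"

(* absolutely_continuous M N means that N is absolutely continuous with respect to M.
   The library's KL_divergence is a Bochner integral, hence 0 rather than +infinity when
   the log-density is not integrable; entropy_density (exp 1) M N is log (dN/dM). *)
definition rel_entropy :: "real measure \<Rightarrow> real measure \<Rightarrow> ereal" where
  "rel_entropy \<nu> \<mu> =
     (if absolutely_continuous \<mu> \<nu>
      then ereal_integral \<nu> (\<lambda>x. ereal (entropy_density (exp 1) \<mu> \<nu> x)) else \<infinity>)"

definition gen_gauss_density :: "real \<Rightarrow> real \<Rightarrow> real" where
  "gen_gauss_density p y =
     1 / (2 * p powr (1 / p) * Gamma (1 + 1 / p)) * exp (- (\<bar>y\<bar> powr p) / p)"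

definition gen_gauss :: "real \<Rightarrow> real measure" where
  "gen_gauss p = density lborel (\<lambda>y. ennreal (gen_gauss_density p y))"

definition Phi :: "real \<Rightarrow> real \<times> real \<times> real \<Rightarrow> ereal" where
  "Phi p = (\<lambda>(t0, t1, t2). ln_ennreal
     (\<integral>\<^sup>+ y. (\<integral>\<^sup>+ z. ennreal (exp (t0 * z\<^sup>2 + t1 * z * y + t2 * \<bar>y\<bar> powr p)) \<partial>gen_gauss 2)
       \<partial>gen_gauss p))"

definition I_annealed :: "real \<Rightarrow> real \<Rightarrow> ereal" where
  "I_annealed p w =
     Inf {legendre (Phi p) (\<tau>0, \<tau>1, \<tau>2) | \<tau>0 \<tau>1 \<tau>2.
       \<tau>0 > 0 \<and> \<tau>2 > 0 \<and> \<tau>0 powr (- 1 / 2) * \<tau>1 * \<tau>2 powr (- 1 / p) = w}"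

definition Lambda :: "real \<Rightarrow> real \<times> real \<Rightarrow> ereal" where
  "Lambda p = (\<lambda>(t1, t2). ln_ennreal
     (\<integral>\<^sup>+ y. ennreal (exp (t1 * y + t2 * \<bar>y\<bar> powr p)) \<partial>gen_gauss p))"

definition Psi :: "real \<Rightarrow> real measure \<Rightarrow> real \<times> real \<Rightarrow> ereal" where
  "Psi p \<nu> = (\<lambda>(t1, t2). ereal_integral \<nu> (\<lambda>u. Lambda p (t1 * u, t2)))"

definition I_quenched :: "real \<Rightarrow> real measure \<Rightarrow> real \<Rightarrow> ereal" where
  "I_quenched p \<nu> w =
     Inf {legendre (Psi p \<nu>) (\<tau>1, \<tau>2) | \<tau>1 \<tau>2.
       \<tau>2 > 0 \<and> \<tau>1 * \<tau>2 powr (- 1 / p) = w}"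

end

theory Submission
  imports Defs
begin

text \<open>
  Let \<open>X(y, z) = (z\<^sup>2, z * y, \<bar>y\<bar> powr p)\<close>, so that \<open>Phi p t\<close> is the logarithm of the exponential moment
  of \<open>t \<bullet> X\<close>. Rescaling \<open>z\<close> shows that the annealed infimum may be restricted to \<open>\<tau>0 = 1\<close>. There
  the Gibbs inequality \<open>Phi(t) \<ge> t0 * m(\<nu>) + Psi \<nu> (t1, t2) - H(\<nu>)\<close>, with \<open>m\<close> the second moment and
  \<open>H\<close> the relative entropy, together with \<open>t0 < 1 / 2\<close> on the domain of \<open>Phi\<close> gives one inequality.

  Conversely let \<open>\<tau> = (1, \<tau>1, \<tau>2)\<close>. If \<open>\<bar>w\<bar> \<ge> 1\<close>, then \<open>\<tau>\<close> is not an interior point of the convex hull of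
  the range of \<open>X\<close>, and \<open>t \<bullet> \<tau> - Phi(t)\<close> is unbounded along an outer normal. If \<open>\<bar>w\<bar> < 1\<close>, no
  hyperplane through \<open>\<tau>\<close> has \<open>X\<close> almost surely on one side, so \<open>t \<bullet> \<tau> - Phi(t)\<close> attains its maximum;
  as the domain of \<open>Phi\<close> is open, \<open>X\<close> has mean \<open>\<tau>\<close> under the measure tilted by the maximiser. Its
  marginal \<open>\<nu>\<close> in \<open>z\<close> has second moment one and attains equality in the Gibbs inequality, and
  \<open>(t1, t2)\<close> attains the Legendre transform of \<open>Psi \<nu>\<close> by the conditional Jensen inequality given \<open>z\<close>.
\<close>

section \<open>Minimising exponential moments\<close>

lemma ereal_integral_eq_integral:
  assumes "integrable M f"
  shows "ereal_integral M (\<lambda>x. ereal (f x)) = ereal (integral\<^sup>L M f)"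
proof -
  have "(\<integral>\<^sup>+ x. ennreal (f x) \<partial>M) < \<infinity>" "(\<integral>\<^sup>+ x. ennreal (- f x) \<partial>M) < \<infinity>"
    using assms by (auto simp: real_integrable_def less_top)
  then show ?thesis
    unfolding ereal_integral_def real_lebesgue_integral_def[OF assms]
    by (cases "\<integral>\<^sup>+ x. ennreal (f x) \<partial>M" ; cases "\<integral>\<^sup>+ x. ennreal (- f x) \<partial>M")
       (auto simp: enn2ereal_ennreal)
qed

text \<open>Jensen's inequality for the exponential, through \<open>f \<le> exp f - 1\<close>. It
  serves both the Gibbs inequality and the conditional comparison of two tilts.\<close>

lemma integral_nonpos_of_exp:
  assumes "prob_space M" and f: "integrable M f"
    and le: "(\<integral>\<^sup>+ x. ennreal (exp (f x)) \<partial>M) \<le> 1"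
  shows "integral\<^sup>L M f \<le> 0"
proof -
  interpret prob_space M by fact
  have m: "f \<in> borel_measurable M" using f by auto
  have i: "integrable M (\<lambda>x. exp (f x))"
    unfolding integrable_iff_bounded using m le by (auto simp: le_less_trans[OF le])
  have "ennreal (integral\<^sup>L M (\<lambda>x. exp (f x))) \<le> 1"
    using le nn_integral_eq_integral[OF i] by simp
  then have 1: "integral\<^sup>L M (\<lambda>x. exp (f x)) \<le> 1"
    by (simp add: ennreal_le_1)
  have "integral\<^sup>L M f \<le> integral\<^sup>L M (\<lambda>x. exp (f x) - 1)"
  proof (rule integral_mono)
    show "f x \<le> exp (f x) - 1" for x using exp_ge_add_one_self[of "f x"] by linarith
  qed (use f i in auto)
  also have "\<dots> = integral\<^sup>L M (\<lambda>x. exp (f x)) - 1"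
    using i by (simp add: prob_space)
  finally show ?thesis using 1 by simp
qed

text \<open>Bernoulli's inequality with base \<open>exp (x / k)\<close>. The bound is uniform in
  \<open>k\<close>, so it yields an integrable majorant for difference quotients of the
  exponential.\<close>

lemma exp_difference_quotient_le:
  fixes x :: real
  assumes "k > 0"
  shows "(exp (x / real k) - 1) * real k \<le> exp x - 1"
proof -
  have "1 + real k * (exp (x / real k) - 1) \<le> (1 + (exp (x / real k) - 1)) ^ k"
    by (rule Bernoulli_inequality) simp
  also have "\<dots> = exp x"
    using assms by (simp add: exp_of_nat_mult[symmetric])
  finally show ?thesis by (simp add: algebra_simps)
qed

lemma integrable_of_exp_integrable:
  assumes m: "f \<in> borel_measurable M"
    and e: "(\<integral>\<^sup>+ x. ennreal (exp (f x)) \<partial>M) < \<infinity>" "(\<integral>\<^sup>+ x. ennreal (exp (- f x)) \<partial>M) < \<infinity>"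
  shows "integrable M (\<lambda>x. exp (f x))" "integrable M f"
proof -
  show i: "integrable M (\<lambda>x. exp (f x))"
    unfolding integrable_iff_bounded using m e by auto
  have i': "integrable M (\<lambda>x. exp (- f x))"
    unfolding integrable_iff_bounded using m e by auto
  show "integrable M f"
  proof (rule Bochner_Integration.integrable_bound)
    show "integrable M (\<lambda>x. exp (f x) + exp (- f x))" using i i' by simp
    have "\<bar>y\<bar> \<le> exp y + exp (- y)" for y :: real
      using exp_ge_add_one_self[of y] exp_ge_add_one_self[of "-y"] exp_gt_zero[of y] exp_gt_zero[of "-y"]
      by (cases "y \<ge> 0") linarith+
    then have "norm y \<le> norm (exp y + exp (- y))" for y :: real
      unfolding real_norm_def by (rule order_trans[OF _ abs_ge_self])
    then show "AE x in M. norm (f x) \<le> norm (exp (f x) + exp (- f x))" by (intro AE_I2)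
  qed (use m in auto)
qed

text \<open>By \<open>min\<close>, the integral of \<open>exp (s * f)\<close> at
  \<open>s = 0\<close> is at most its value at every \<open>s = 1 / k\<close>. The difference
  quotients are thus nonnegative, and they converge to the integral of \<open>f\<close>; testing one
  side of 0 gives an inequality.\<close>

lemma integral_nonneg_of_exp_min:
  assumes "finite_measure M" and m: "f \<in> borel_measurable M"
    and e: "(\<integral>\<^sup>+ x. ennreal (exp (f x)) \<partial>M) < \<infinity>" "(\<integral>\<^sup>+ x. ennreal (exp (- f x)) \<partial>M) < \<infinity>"
    and min: "\<And>k::nat. k > 0 \<Longrightarrow> emeasure M (space M) \<le> (\<integral>\<^sup>+ x. ennreal (exp (f x / real k)) \<partial>M)"
  shows "integral\<^sup>L M f \<ge> 0"
proof -
  interpret finite_measure M by fact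
  note i = integrable_of_exp_integrable[OF m e]
  let ?q = "\<lambda>k x. (exp (f x / real (Suc k)) - 1) * real (Suc k)"
  \<comment> \<open>Each quotient is trapped between \<open>f x\<close> and
    \<open>exp (f x) - 1\<close>, which dominates the whole sequence.\<close>
  have b1: "f x \<le> ?q k x" for k x
  proof -
    have "1 + f x / real (Suc k) \<le> exp (f x / real (Suc k))"
      by (rule exp_ge_add_one_self)
    then have "(f x / real (Suc k)) * real (Suc k) \<le> ?q k x"
      by (intro mult_right_mono) (linarith, simp)
    then show ?thesis by simp
  qed
  have b2: "?q k x \<le> exp (f x) - 1" for k x
    by (rule exp_difference_quotient_le) simp
  have bd: "norm (?q k x) \<le> \<bar>f x\<bar> + exp (f x) + 1" for k x
    using b1[where k=k and x=x] b2[where k=k and x=x] exp_gt_zero[of "f x"] unfolding real_norm_def abs_if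
    by (smt (verit))
  have lim: "(\<lambda>k. ?q k x) \<longlonglongrightarrow> f x" for x
  proof -
    have "((\<lambda>h. (exp (f x * h) - 1) / h) \<longlongrightarrow> f x) (at 0)"
    proof -
      have "((\<lambda>h. exp (f x * h)) has_field_derivative f x) (at 0)"
        by (auto intro!: derivative_eq_intros)
      then show ?thesis unfolding has_field_derivative_iff by simp
    qed
    moreover have "filterlim (\<lambda>k. inverse (real (Suc k))) (at 0) sequentially"
      unfolding filterlim_at by (auto simp: LIMSEQ_inverse_real_of_nat simp del: of_nat_Suc)
    ultimately have "((\<lambda>k. (exp (f x * inverse (real (Suc k))) - 1) / inverse (real (Suc k))) \<longlonglongrightarrow> f x)"
      by (rule filterlim_compose)
    then show ?thesis by (simp add: field_simps del: of_nat_Suc)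
  qed
  have w: "integrable M (\<lambda>x. \<bar>f x\<bar> + exp (f x) + 1)" using i by auto
  have int: "integrable M (?q k)" for k
    by (rule Bochner_Integration.integrable_bound[OF w])
       (use m in measurable, intro AE_I2 order_trans[OF bd], simp)
  have L: "(\<lambda>k. integral\<^sup>L M (?q k)) \<longlonglongrightarrow> integral\<^sup>L M f"
    by (rule integral_dominated_convergence[OF _ _ w])
       (use m in measurable, use m in measurable, intro AE_I2 lim, intro AE_I2 bd)
  have "0 \<le> integral\<^sup>L M (?q k)" for k
  proof -
    have eq: "(\<lambda>x. exp (f x / real (Suc k))) = (\<lambda>x. ?q k x * inverse (real (Suc k)) + 1)"
      by (rule ext) (simp add: field_simps del: of_nat_Suc)
    have ie: "integrable M (\<lambda>x. exp (f x / real (Suc k)))"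
      by (subst eq) (intro Bochner_Integration.integrable_add integrable_mult_left int integrable_const)
    have "ennreal (measure M (space M)) \<le> ennreal (integral\<^sup>L M (\<lambda>x. exp (f x / real (Suc k))))"
      using min[of "Suc k"] nn_integral_eq_integral[OF ie] emeasure_eq_measure by simp
    then have "measure M (space M) \<le> integral\<^sup>L M (\<lambda>x. exp (f x / real (Suc k)))"
      by (subst (asm) ennreal_le_iff) auto
    moreover have "integral\<^sup>L M (?q k) = (integral\<^sup>L M (\<lambda>x. exp (f x / real (Suc k))) - measure M (space M)) * real (Suc k)"
      using ie by (subst integral_mult_left_zero, subst Bochner_Integration.integral_diff) auto
    ultimately show ?thesis by (simp del: of_nat_Suc)
  qed
  then show ?thesis using LIMSEQ_le_const[OF L] by blast
qed

lemma integral_eq_0_of_exp_min: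
  assumes "finite_measure M" and m: "f \<in> borel_measurable M"
    and e: "(\<integral>\<^sup>+ x. ennreal (exp (f x)) \<partial>M) < \<infinity>" "(\<integral>\<^sup>+ x. ennreal (exp (- f x)) \<partial>M) < \<infinity>"
    and min: "\<And>s. emeasure M (space M) \<le> (\<integral>\<^sup>+ x. ennreal (exp (s * f x)) \<partial>M)"
  shows "integrable M f" "integral\<^sup>L M f = 0"
proof -
  show "integrable M f" using integrable_of_exp_integrable[OF m e] by simp
  have "integral\<^sup>L M f \<ge> 0"
    by (rule integral_nonneg_of_exp_min[OF assms(1) m e]) (use min[of "inverse (real _)"] in \<open>auto simp: field_simps\<close>)
  moreover have "integral\<^sup>L M (\<lambda>x. - f x) \<ge> 0"
    by (rule integral_nonneg_of_exp_min[OF assms(1)]) (use m e min[of "-inverse (real _)"] in \<open>auto simp: field_simps\<close>)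
  ultimately show "integral\<^sup>L M f = 0" by simp
qed

text \<open>Otherwise parameters of norm tending to infinity have normalised directions accumulating
  at some \<open>l\<close>. Where \<open>l \<bullet> X\<close> is positive the exponentials diverge
  along the subsequence, so by Fatou's lemma this set is null, contradicting
  \<open>sep\<close>.\<close>

lemma bounded_exp_sublevel:
  fixes X :: "'b \<Rightarrow> 'a::euclidean_space"
  assumes m[measurable]: "X \<in> borel_measurable M"
    and sep: "\<And>u. u \<noteq> 0 \<Longrightarrow> \<not> (AE v in M. u \<bullet> X v \<le> 0)"
    and "C < \<infinity>"
  shows "bounded {t. (\<integral>\<^sup>+ v. ennreal (exp (t \<bullet> X v)) \<partial>M) \<le> C}"
proof (rule ccontr)
  assume "\<not> ?thesis"
  then have "\<forall>n. \<exists>t. (\<integral>\<^sup>+ v. ennreal (exp (t \<bullet> X v)) \<partial>M) \<le> C \<and> norm t > real n"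
    unfolding bounded_iff by (auto simp: not_le)
  then obtain t where t: "\<And>n. (\<integral>\<^sup>+ v. ennreal (exp (t n \<bullet> X v)) \<partial>M) \<le> C" "\<And>n. norm (t n) > real n"
    by metis
  have tp: "norm (t n) > 0" for n using t(2)[of n] by linarith
  define u where "u n = t n /\<^sub>R norm (t n)" for n
  have us: "u n \<in> sphere 0 1" for n using tp[of n] by (auto simp: u_def)
  obtain l r where l: "l \<in> sphere 0 1" and r: "strict_mono r" and lim: "(u \<circ> r) \<longlonglongrightarrow> l"
    using compact_sphere[of "0::'a" 1] us unfolding compact_def by metis
  have tu: "t n = norm (t n) *\<^sub>R u n" for n using tp[of n] by (simp add: u_def)
  have "(\<integral>\<^sup>+ v. liminf (\<lambda>n. ennreal (exp (t (r n) \<bullet> X v))) \<partial>M) \<le> liminf (\<lambda>n. \<integral>\<^sup>+ v. ennreal (exp (t (r n) \<bullet> X v)) \<partial>M)"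
    by (rule nn_integral_liminf) simp
  also have "\<dots> \<le> liminf (\<lambda>n. C)" by (intro Liminf_mono) (use t in auto)
  also have "\<dots> = C" by (simp add: Liminf_const)
  finally have "(\<integral>\<^sup>+ v. liminf (\<lambda>n. ennreal (exp (t (r n) \<bullet> X v))) \<partial>M) \<noteq> \<infinity>" using \<open>C < \<infinity>\<close> by auto
  then have "AE v in M. liminf (\<lambda>n. ennreal (exp (t (r n) \<bullet> X v))) \<noteq> \<infinity>"
    by (rule nn_integral_PInf_AE[rotated]) simp
  then have "AE v in M. l \<bullet> X v \<le> 0"
  proof (rule AE_mp, intro AE_I2 impI)
    fix v assume *: "liminf (\<lambda>n. ennreal (exp (t (r n) \<bullet> X v))) \<noteq> \<infinity>"
    show "l \<bullet> X v \<le> 0"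
    proof (rule ccontr)
      assume p: "\<not> l \<bullet> X v \<le> 0"
      have 1: "(\<lambda>n. u (r n) \<bullet> X v) \<longlonglongrightarrow> l \<bullet> X v"
        using lim by (auto intro!: tendsto_intros simp: o_def)
      have 2: "filterlim (\<lambda>n. norm (t (r n))) at_top sequentially"
      proof (rule filterlim_at_top_mono[OF filterlim_real_sequentially])
        show "\<forall>\<^sub>F n in sequentially. real n \<le> norm (t (r n))"
          using t(2) seq_suble[OF r] by (intro always_eventually allI) (meson le_less_trans less_imp_le of_nat_mono order_trans)
      qed
      have "filterlim (\<lambda>n. u (r n) \<bullet> X v * norm (t (r n))) at_top sequentially"
        by (rule filterlim_tendsto_pos_mult_at_top[OF 1 _ 2]) (use p in auto)
      then have "filterlim (\<lambda>n. t (r n) \<bullet> X v) at_top sequentially"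
        by (subst tu) (simp add: mult.commute)
      then have "filterlim (\<lambda>n. exp (t (r n) \<bullet> X v)) at_top sequentially"
        by (rule filterlim_compose[OF exp_at_top])
      then have "((\<lambda>n. ennreal (exp (t (r n) \<bullet> X v))) \<longlonglongrightarrow> top)"
        by (simp add: ennreal_tendsto_top_eq_at_top)
      then show False using * lim_imp_Liminf[OF sequentially_bot] by (metis infinity_ennreal_def)
    qed
  qed
  moreover have "l \<noteq> 0" using l by auto
  ultimately show False using sep by blast
qed

text \<open>The direct method: the value at 0 is finite, a minimising sequence eventually stays in a
  bounded sublevel set, and Fatou's lemma supplies lower semicontinuity even where the integral may
  be infinite.\<close>

lemma exp_integral_attains_min:
  fixes X :: "'b \<Rightarrow> 'a::euclidean_space"
  assumes "finite_measure M" and m[measurable]: "X \<in> borel_measurable M"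
    and sep: "\<And>u. u \<noteq> 0 \<Longrightarrow> \<not> (AE v in M. u \<bullet> X v \<le> 0)"
  shows "\<exists>t. \<forall>s. (\<integral>\<^sup>+ v. ennreal (exp (t \<bullet> X v)) \<partial>M) \<le> (\<integral>\<^sup>+ v. ennreal (exp (s \<bullet> X v)) \<partial>M)"
proof -
  interpret finite_measure M by fact
  let ?F = "\<lambda>t. (\<integral>\<^sup>+ v. ennreal (exp (t \<bullet> X v)) \<partial>M)"
  obtain f where f: "decseq f" "range f \<subseteq> range ?F" "(INF t. ?F t) = (INF i. f i)"
    using ennreal_Inf_countable_INF[of "range ?F"] by auto
  have "(INF t. ?F t) \<le> ?F 0" by (rule INF_lower) simp
  also have "\<dots> < \<infinity>" using emeasure_finite[of "space M"] by (simp add: less_top[symmetric])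
  \<comment> \<open>The minimising sequence may begin with infinite values; from \<open>N\<close> on
    its terms lie in a sublevel set of finite level.\<close>
  finally obtain N where N: "f N < \<infinity>" unfolding f(3) by (auto simp: INF_less_iff)
  have "\<exists>s. f n = ?F s" for n using f(2) by blast
  then obtain t where t: "\<And>n. f n = ?F (t n)" using choice[of "\<lambda>n s. f n = ?F s"] by blast
  have "bounded {s. ?F s \<le> f N}" using bounded_exp_sublevel[OF m sep N] .
  moreover have "range (\<lambda>n. t (n + N)) \<subseteq> {s. ?F s \<le> f N}"
    unfolding image_subset_iff mem_Collect_eq t[symmetric]
    by (intro ballI decseqD[OF f(1)]) simp
  ultimately have "bounded (range (\<lambda>n. t (n + N)))" by (rule bounded_subset)
  then obtain l r where r: "strict_mono (r::nat\<Rightarrow>nat)" and lim: "((\<lambda>n. t (n + N)) \<circ> r) \<longlonglongrightarrow> l"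
    using bounded_imp_convergent_subsequence by blast
  have "?F l = (\<integral>\<^sup>+ v. liminf (\<lambda>n. ennreal (exp (t (r n + N) \<bullet> X v))) \<partial>M)"
  proof (rule nn_integral_cong)
    fix v
    have "(\<lambda>n. t (r n + N)) \<longlonglongrightarrow> l" using lim by (simp add: o_def)
    then have "(\<lambda>n. ennreal (exp (t (r n + N) \<bullet> X v))) \<longlonglongrightarrow> ennreal (exp (l \<bullet> X v))"
      by (intro tendsto_ennrealI tendsto_exp tendsto_inner tendsto_const)
    then show "ennreal (exp (l \<bullet> X v)) = liminf (\<lambda>n. ennreal (exp (t (r n + N) \<bullet> X v)))"
      by (rule lim_imp_Liminf[OF sequentially_bot, symmetric])
  qed
  also have "\<dots> \<le> liminf (\<lambda>n. ?F (t (r n + N)))" by (rule nn_integral_liminf) simp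
  also have "\<dots> = (INF i. f i)"
  proof -
    have "(f \<circ> (\<lambda>n. r n + N)) \<longlonglongrightarrow> (INF i. f i)"
      by (rule LIMSEQ_subseq_LIMSEQ[OF LIMSEQ_INF[OF f(1)]]) (use r in \<open>auto simp: strict_mono_def\<close>)
    then show ?thesis unfolding o_def t by (rule lim_imp_Liminf[OF sequentially_bot])
  qed
  finally have "?F l \<le> (INF t. ?F t)" using f(3) by simp
  then show ?thesis by (meson INF_lower UNIV_I order_trans)
qed

section \<open>Generalised Gaussian measures\<close>

text \<open>Completing the square turns the integrand into a multiple of the normal density with
  mean \<open>b / (2 * a)\<close> and variance \<open>1 / (2 * a)\<close>.\<close>

lemma nn_integral_exp_quadratic:
  assumes "a > (0::real)"
  shows "(\<integral>\<^sup>+ z. ennreal (exp (b * z - a * z\<^sup>2)) \<partial>lborel) = ennreal (sqrt (pi / a) * exp (b\<^sup>2 / (4 * a)))"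
proof -
  define \<mu> where "\<mu> = b / (2 * a)"
  define \<sigma> where "\<sigma> = 1 / sqrt (2 * a)"
  have s: "\<sigma> > 0" "\<sigma>\<^sup>2 = 1 / (2 * a)" using assms by (auto simp: \<sigma>_def power_divide)
  have e: "exp (b * z - a * z\<^sup>2) = (sqrt (pi / a) * exp (b\<^sup>2 / (4 * a))) * normal_density \<mu> \<sigma> z" for z
  proof -
    have "- (z - \<mu>)\<^sup>2 / (2 * \<sigma>\<^sup>2) = b * z - a * z\<^sup>2 - b\<^sup>2 / (4 * a)"
      using assms unfolding s(2) \<mu>_def by (simp add: field_simps power2_eq_square)
    moreover have "sqrt (2 * pi * \<sigma>\<^sup>2) = sqrt (pi / a)" unfolding s(2) by simp
    ultimately show ?thesis
      using assms unfolding normal_density_def by (simp add: exp_diff)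
  qed
  have "(\<integral>\<^sup>+ z. ennreal (normal_density \<mu> \<sigma> z) \<partial>lborel) = 1"
    using s(1) by (subst nn_integral_eq_integral) auto
  then show ?thesis
    unfolding e using assms by (subst ennreal_mult) (auto simp: nn_integral_cmult)
qed

text \<open>The half-line on which \<open>b * x\<close> is nonnegative has infinite length, so a
  linear term of either sign can be ignored when proving divergence.\<close>

lemma nn_integral_lborel_eq_infinity:
  fixes b k :: real
  assumes "k > 0" "\<And>x. b * x \<ge> 0 \<Longrightarrow> ennreal k \<le> f x"
  shows "(\<integral>\<^sup>+ x. f x \<partial>lborel) = \<infinity>"
proof -
  define S where "S = (if b \<ge> 0 then {0..} else {..0::real})"
  have Sb: "S \<in> sets borel" by (auto simp: S_def)
  have "ennreal (real n) \<le> emeasure lborel S" for n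
  proof -
    have "emeasure lborel (if b \<ge> 0 then {0..real n} else {-real n..0}) \<le> emeasure lborel S"
      using Sb by (intro emeasure_mono) (auto simp: S_def)
    then show ?thesis by (simp split: if_splits)
  qed
  then have "emeasure lborel S \<ge> (SUP n. ennreal (real n))" by (rule SUP_least)
  then have S: "emeasure lborel S = \<infinity>" "S \<in> sets borel"
    using Sb ennreal_SUP_of_nat_eq_top by (auto simp: ennreal_of_nat_eq_real_of_nat[symmetric] top.extremum_unique)
  have "b * x \<ge> 0" if "x \<in> S" for x
    using that by (auto simp: S_def mult_nonpos_nonpos split: if_splits)
  then have "(\<integral>\<^sup>+ x. ennreal k * indicator S x \<partial>lborel) \<le> (\<integral>\<^sup>+ x. f x \<partial>lborel)"
    by (intro nn_integral_mono) (auto simp: indicator_def intro!: assms)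
  moreover have "(\<integral>\<^sup>+ x. ennreal k * indicator S x \<partial>lborel) = \<infinity>"
    using S assms(1) by (simp add: nn_integral_cmult_indicator ennreal_mult_top)
  ultimately show ?thesis by (simp add: top.extremum_unique)
qed

lemma abs_powr_2: "\<bar>x::real\<bar> powr 2 = x\<^sup>2"
  by (cases "x = 0") (auto simp: powr_numeral)

text \<open>For \<open>p = 2\<close> the extra condition is the positive definiteness of the quadratic form.\<close>
definition Phi_dom :: "real \<Rightarrow> (real \<times> real \<times> real) set" where
  "Phi_dom p = {t. fst t < 1 / 2 \<and> snd (snd t) < 1 / p \<and>
     (p = 2 \<longrightarrow> (fst (snd t))\<^sup>2 < (1 - 2 * fst t) * (1 - 2 * snd (snd t)))}"

text \<open>The sufficient statistic of the exponential family behind \<open>Phi\<close>. The pair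
  is ordered as the factors of \<open>pair_gauss\<close>: \<open>fst v\<close> is the variable
  \<open>y\<close>, \<open>snd v\<close> the Gaussian variable \<open>z\<close>.\<close>

definition stat :: "real \<Rightarrow> real \<times> real \<Rightarrow> real \<times> real \<times> real" where
  "stat p v = ((snd v)\<^sup>2, snd v * fst v, \<bar>fst v\<bar> powr p)"

abbreviation pair_gauss :: "real \<Rightarrow> (real \<times> real) measure" where
  "pair_gauss p \<equiv> gen_gauss p \<Otimes>\<^sub>M gen_gauss 2"

definition gen_gauss_const :: "real \<Rightarrow> real" where
  "gen_gauss_const p = 1 / (2 * p powr (1 / p) * Gamma (1 + 1 / p))"

lemma gen_gauss_density_eq: "gen_gauss_density p y = gen_gauss_const p * exp (- (\<bar>y\<bar> powr p) / p)"
  by (simp add: gen_gauss_density_def gen_gauss_const_def)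

lemma gen_gauss_const_pos: "p > 0 \<Longrightarrow> gen_gauss_const p > 0"
  unfolding gen_gauss_const_def by (auto intro!: divide_pos_pos mult_pos_pos Gamma_real_pos add_pos_pos)

lemma gen_gauss_density_pos: "p > 0 \<Longrightarrow> gen_gauss_density p y > 0"
  unfolding gen_gauss_density_eq using gen_gauss_const_pos by simp

lemma measurable_gen_gauss_density[measurable]: "gen_gauss_density p \<in> borel_measurable borel"
  unfolding gen_gauss_density_def[abs_def] by measurable

lemma sets_gen_gauss[simp, measurable_cong]: "sets (gen_gauss p) = sets borel"
  by (simp add: gen_gauss_def)

lemma space_gen_gauss[simp]: "space (gen_gauss p) = UNIV"
  by (simp add: gen_gauss_def)

lemma nn_integral_gen_gauss:
  assumes "f \<in> borel_measurable borel"
  shows "(\<integral>\<^sup>+ y. f y \<partial>gen_gauss p) = (\<integral>\<^sup>+ y. ennreal (gen_gauss_density p y) * f y \<partial>lborel)"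
  unfolding gen_gauss_def using assms by (subst nn_integral_density) auto

lemma nn_integral_exp_gen_gauss:
  assumes "p > 0" and [measurable]: "f \<in> borel_measurable borel"
  shows "(\<integral>\<^sup>+ y. ennreal (exp (f y)) \<partial>gen_gauss p)
    = ennreal (gen_gauss_const p) * (\<integral>\<^sup>+ y. ennreal (exp (f y - \<bar>y\<bar> powr p / p)) \<partial>lborel)"
proof -
  have "(\<integral>\<^sup>+ y. ennreal (exp (f y)) \<partial>gen_gauss p)
    = (\<integral>\<^sup>+ y. ennreal (gen_gauss_const p) * ennreal (exp (f y - \<bar>y\<bar> powr p / p)) \<partial>lborel)"
    using assms gen_gauss_const_pos[OF assms(1)]
    by (subst nn_integral_gen_gauss)
       (auto simp: gen_gauss_density_eq ennreal_mult[symmetric] exp_diff exp_minus divide_inverse ac_simps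
             intro!: nn_integral_cong)
  also have "\<dots> = ennreal (gen_gauss_const p) * (\<integral>\<^sup>+ y. ennreal (exp (f y - \<bar>y\<bar> powr p / p)) \<partial>lborel)"
    by (intro nn_integral_cmult) simp
  finally show ?thesis .
qed

lemma gen_gauss_density_2: "gen_gauss_density 2 y = std_normal_density y"
proof -
  have half_notin: "(1 / 2 :: real) \<notin> \<int>\<^sub>\<le>\<^sub>0" by (auto dest: nonpos_Ints_nonpos)
  have "Gamma (1 + 1 / 2 :: real) = sqrt pi / 2"
    using Gamma_plus1[OF half_notin, unfolded Gamma_one_half_real] by (simp add: add.commute)
  moreover have "(2::real) powr (1 / 2) = sqrt 2" by (simp add: powr_half_sqrt)
  ultimately have "2 * 2 powr (1 / 2) * Gamma (1 + 1 / 2 :: real) = sqrt (2 * pi)"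
    by (simp add: real_sqrt_mult)
  then show ?thesis
    unfolding gen_gauss_density_def std_normal_density_def abs_powr_2 by simp
qed

lemma gen_gauss_const_2: "gen_gauss_const 2 = 1 / sqrt (2 * pi)"
  using gen_gauss_density_2[of 0] by (simp add: gen_gauss_density_eq std_normal_density_def)

lemma gen_gauss_2_eq: "gen_gauss 2 = density lborel (\<lambda>z. ennreal (std_normal_density z))"
  unfolding gen_gauss_def gen_gauss_density_2 ..

lemma prob_space_gen_gauss_2: "prob_space (gen_gauss 2)"
  unfolding gen_gauss_2_eq by (rule prob_space_normal_density) simp

text \<open>With the Gaussian weight included, the coefficient of \<open>z\<^sup>2\<close> is
  \<open>a - 1 / 2\<close>. If it is negative the integral is Gaussian; otherwise the exponent is at
  least \<open>c\<close> on a half-line.\<close>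

lemma nn_integral_exp_gen_gauss_2:
  "(\<integral>\<^sup>+ z. ennreal (exp (a * z\<^sup>2 + b * z + c)) \<partial>gen_gauss 2) =
    (if a < 1 / 2 then ennreal (exp (b\<^sup>2 / (2 * (1 - 2 * a)) + c) / sqrt (1 - 2 * a)) else \<infinity>)"
proof -
  have e: "a * z\<^sup>2 + b * z + c - \<bar>z\<bar> powr 2 / 2 = b * z - (1 / 2 - a) * z\<^sup>2 + c" for z :: real
    by (simp add: abs_powr_2 algebra_simps)
  have *: "(\<integral>\<^sup>+ z. ennreal (exp (a * z\<^sup>2 + b * z + c)) \<partial>gen_gauss 2)
    = ennreal (1 / sqrt (2 * pi)) * (\<integral>\<^sup>+ z. ennreal (exp (b * z - (1 / 2 - a) * z\<^sup>2 + c)) \<partial>lborel)"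
    by (rule nn_integral_exp_gen_gauss[where p=2 and f="\<lambda>z. a * z\<^sup>2 + b * z + c", unfolded e gen_gauss_const_2]) auto
  show ?thesis
  proof (cases "a < 1 / 2")
    case True
    have "(\<integral>\<^sup>+ z. ennreal (exp (b * z - (1 / 2 - a) * z\<^sup>2 + c)) \<partial>lborel)
      = ennreal (exp c) * (\<integral>\<^sup>+ z. ennreal (exp (b * z - (1 / 2 - a) * z\<^sup>2)) \<partial>lborel)"
      by (subst nn_integral_cmult[symmetric])
         (auto simp: ennreal_mult[symmetric] exp_add mult.commute intro!: nn_integral_cong)
    also have "\<dots> = ennreal (exp c * (sqrt (pi / (1 / 2 - a)) * exp (b\<^sup>2 / (4 * (1 / 2 - a)))))"
      using True by (subst nn_integral_exp_quadratic) (auto simp: ennreal_mult[symmetric])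
    finally have "(\<integral>\<^sup>+ z. ennreal (exp (a * z\<^sup>2 + b * z + c)) \<partial>gen_gauss 2)
      = ennreal (1 / sqrt (2 * pi) * (exp c * (sqrt (pi / (1 / 2 - a)) * exp (b\<^sup>2 / (4 * (1 / 2 - a))))))"
      using True by (simp only: *) (subst ennreal_mult[symmetric], auto)
    moreover have "sqrt (pi / (1 / 2 - a)) = sqrt (2 * pi) / sqrt (1 - 2 * a)"
      using True by (simp add: real_sqrt_divide[symmetric] field_simps)
    ultimately show ?thesis using True
      by (simp add: exp_add mult.commute right_diff_distrib)
  next
    case False
    have "(\<integral>\<^sup>+ z. ennreal (exp (b * z - (1 / 2 - a) * z\<^sup>2 + c)) \<partial>lborel) = \<infinity>"
    proof (rule nn_integral_lborel_eq_infinity[where k = "exp c" and b = b])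
      fix x assume "b * x \<ge> 0"
      moreover have "(1 / 2 - a) * x\<^sup>2 \<le> 0" using False by (intro mult_nonpos_nonneg) auto
      ultimately show "ennreal (exp c) \<le> ennreal (exp (b * x - (1 / 2 - a) * x\<^sup>2 + c))" by simp
    qed simp
    then show ?thesis using False unfolding * by (simp add: ennreal_mult_top)
  qed
qed

text \<open>For \<open>p > 2\<close> the power outgrows every quadratic; at \<open>p = 2\<close>
  both terms are quadratic and the gap \<open>b - a\<close> is the only margin.\<close>

lemma square_le_powr_coercive:
  assumes p: "p \<ge> 2" and "b > 0" and "p = 2 \<Longrightarrow> a < b"
  shows "\<exists>\<eta> > 0. \<exists>C. \<forall>y::real. a * y\<^sup>2 - b * \<bar>y\<bar> powr p \<le> C - \<eta> * y\<^sup>2"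
proof (cases "p = 2")
  case True
  then show ?thesis using assms
    by (intro exI[of _ "b - a"] conjI exI[of _ 0]) (auto simp: abs_powr_2 algebra_simps)
next
  case False
  \<comment> \<open>The summand 1 in \<open>K\<close> pays for \<open>- y\<^sup>2\<close> on the
    right. \<open>R\<close> solves \<open>b * R powr (p - 2) = K\<close>, so the power term absorbs
    \<open>K * y\<^sup>2\<close> outside radius \<open>R\<close>, while \<open>K * R\<^sup>2\<close>
    bounds it inside.\<close>
  define K where "K = \<bar>a\<bar> + 1"
  define R where "R = (K / b) powr (1 / (p - 2))"
  have K: "K > 0" "a + 1 \<le> K" by (auto simp: K_def)
  have R: "R > 0" using K assms by (auto simp: R_def)
  have RK: "b * R powr (p - 2) = K" using False p assms K by (simp add: R_def powr_powr)
  have "a * y\<^sup>2 - b * \<bar>y\<bar> powr p \<le> K * R\<^sup>2 - 1 * y\<^sup>2" for y :: real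
  proof (cases "\<bar>y\<bar> \<ge> R")
    case True
    have y: "\<bar>y\<bar> > 0" using True R by linarith
    have "\<bar>y\<bar> powr p = \<bar>y\<bar> powr (p - 2) * y\<^sup>2"
      using y by (simp add: powr_diff powr_numeral)
    moreover have "R powr (p - 2) \<le> \<bar>y\<bar> powr (p - 2)"
      using True R p by (intro powr_mono2) auto
    ultimately have "K * y\<^sup>2 \<le> b * \<bar>y\<bar> powr p"
      unfolding RK[symmetric] using assms by (auto intro!: mult_left_mono mult_right_mono simp: mult.assoc)
    moreover have "(a + 1) * y\<^sup>2 \<le> K * y\<^sup>2" using K by (intro mult_right_mono) auto
    moreover have "K * R\<^sup>2 \<ge> 0" using K by simp
    ultimately show ?thesis by (simp add: algebra_simps)
  next
    case False
    then have "y\<^sup>2 \<le> R\<^sup>2" by (metis abs_le_square_iff abs_of_pos R less_eq_real_def not_le)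
    then have "K * y\<^sup>2 \<le> K * R\<^sup>2" using K by simp
    moreover have "(a + 1) * y\<^sup>2 \<le> K * y\<^sup>2" using K by (intro mult_right_mono) auto
    moreover have "b * \<bar>y\<bar> powr p \<ge> 0" using assms by simp
    ultimately show ?thesis by (simp add: algebra_simps)
  qed
  then show ?thesis by (intro exI[of _ 1] conjI exI[of _ "K * R\<^sup>2"]) auto
qed

section \<open>The domains of \<open>Phi\<close> and \<open>Lambda\<close>\<close>

text \<open>Coercivity leaves a Gaussian integral. As \<open>K\<close> and \<open>\<eta>\<close> do
  not depend on \<open>x\<close>, the logarithm grows at most quadratically in
  \<open>x\<close>.\<close>

lemma nn_integral_exp_powr_le:
  assumes p: "p \<ge> 2" and "b > 0" and "p = 2 \<Longrightarrow> a < b"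
  shows "\<exists>K > 0. \<exists>\<eta> > 0. \<forall>x::real.
    (\<integral>\<^sup>+ y. ennreal (exp (x * y + a * y\<^sup>2 - b * \<bar>y\<bar> powr p)) \<partial>lborel) \<le> ennreal (K * exp (x\<^sup>2 / (4 * \<eta>)))"
proof -
  obtain \<eta> C where \<eta>: "\<eta> > 0" and C: "\<And>y::real. a * y\<^sup>2 - b * \<bar>y\<bar> powr p \<le> C - \<eta> * y\<^sup>2"
    using square_le_powr_coercive[OF assms] by blast
  have "(\<integral>\<^sup>+ y. ennreal (exp (x * y + a * y\<^sup>2 - b * \<bar>y\<bar> powr p)) \<partial>lborel)
    \<le> ennreal ((exp C * sqrt (pi / \<eta>)) * exp (x\<^sup>2 / (4 * \<eta>)))" for x
  proof -
    have "(\<integral>\<^sup>+ y. ennreal (exp (x * y + a * y\<^sup>2 - b * \<bar>y\<bar> powr p)) \<partial>lborel)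
      \<le> (\<integral>\<^sup>+ y. ennreal (exp C) * ennreal (exp (x * y - \<eta> * y\<^sup>2)) \<partial>lborel)"
    proof (rule nn_integral_mono)
      fix y :: real
      have "exp (x * y + a * y\<^sup>2 - b * \<bar>y\<bar> powr p) \<le> exp (C + (x * y - \<eta> * y\<^sup>2))"
        using C[of y] by simp
      then show "ennreal (exp (x * y + a * y\<^sup>2 - b * \<bar>y\<bar> powr p)) \<le> ennreal (exp C) * ennreal (exp (x * y - \<eta> * y\<^sup>2))"
        by (simp add: ennreal_mult[symmetric] exp_add)
    qed
    also have "\<dots> = ennreal (exp C) * ennreal (sqrt (pi / \<eta>) * exp (x\<^sup>2 / (4 * \<eta>)))"
      using \<eta> by (simp add: nn_integral_cmult nn_integral_exp_quadratic)
    also have "\<dots> = ennreal ((exp C * sqrt (pi / \<eta>)) * exp (x\<^sup>2 / (4 * \<eta>)))"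
      using \<eta> by (simp add: ennreal_mult[symmetric] mult.assoc)
    finally show ?thesis .
  qed
  then show ?thesis using \<eta> by (intro exI[of _ "exp C * sqrt (pi / \<eta>)"] exI[of _ \<eta>] conjI) auto
qed

lemma finite_gen_gauss:
  assumes "p \<ge> 2"
  shows "finite_measure (gen_gauss p)"
proof
  obtain K \<eta> where *: "\<And>x::real. (\<integral>\<^sup>+ y. ennreal (exp (x * y + 0 * y\<^sup>2 - (1 / p) * \<bar>y\<bar> powr p)) \<partial>lborel)
      \<le> ennreal (K * exp (x\<^sup>2 / (4 * \<eta>)))"
    using nn_integral_exp_powr_le[OF assms, of "1 / p" 0] assms by auto
  have "emeasure (gen_gauss p) UNIV = (\<integral>\<^sup>+ y. ennreal (exp 0) \<partial>gen_gauss p)" by simp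
  also have "\<dots> = ennreal (gen_gauss_const p) * (\<integral>\<^sup>+ y. ennreal (exp (0 - \<bar>y\<bar> powr p / p)) \<partial>lborel)"
    using assms by (intro nn_integral_exp_gen_gauss) auto
  also have "\<dots> < \<infinity>"
    using *[of 0] by (simp add: ennreal_mult_less_top order.strict_trans1[OF _ ennreal_less_top])
  finally show "emeasure (gen_gauss p) (space (gen_gauss p)) \<noteq> \<infinity>" by simp
qed

lemma measurable_stat[measurable]: "stat p \<in> borel_measurable (borel \<Otimes>\<^sub>M borel)"
  unfolding stat_def[abs_def] by measurable

lemma inner_stat: "t \<bullet> stat p (y, z) = fst t * z\<^sup>2 + fst (snd t) * z * y + snd (snd t) * \<bar>y\<bar> powr p"
  by (cases t) (simp add: stat_def algebra_simps)

lemma sets_pair_gauss[simp, measurable_cong]: "sets (pair_gauss p) = sets (borel \<Otimes>\<^sub>M borel)"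
  by (intro sets_pair_measure_cong) auto

lemma nn_integral_pair_gauss:
  assumes "p \<ge> 2" "f \<in> borel_measurable (borel \<Otimes>\<^sub>M borel)"
  shows "(\<integral>\<^sup>+ v. f v \<partial>pair_gauss p) = (\<integral>\<^sup>+ y. \<integral>\<^sup>+ z. f (y, z) \<partial>gen_gauss 2 \<partial>gen_gauss p)"
    and "(\<integral>\<^sup>+ v. f v \<partial>pair_gauss p) = (\<integral>\<^sup>+ z. \<integral>\<^sup>+ y. f (y, z) \<partial>gen_gauss p \<partial>gen_gauss 2)"
proof -
  interpret A: finite_measure "gen_gauss p" by (rule finite_gen_gauss) fact
  interpret B: prob_space "gen_gauss 2" by (rule prob_space_gen_gauss_2)
  interpret pair_sigma_finite "gen_gauss p" "gen_gauss 2" ..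
  have f: "f \<in> borel_measurable (pair_gauss p)"
    using assms(2) measurable_cong_sets[OF sets_pair_gauss refl] by blast
  show "(\<integral>\<^sup>+ v. f v \<partial>pair_gauss p) = (\<integral>\<^sup>+ y. \<integral>\<^sup>+ z. f (y, z) \<partial>gen_gauss 2 \<partial>gen_gauss p)"
    by (rule B.nn_integral_fst[OF f, symmetric])
  show "(\<integral>\<^sup>+ v. f v \<partial>pair_gauss p) = (\<integral>\<^sup>+ z. \<integral>\<^sup>+ y. f (y, z) \<partial>gen_gauss p \<partial>gen_gauss 2)"
    using nn_integral_snd[of f] f by simp
qed

lemma Phi_eq:
  assumes "p \<ge> 2"
  shows "Phi p t = ln_ennreal (\<integral>\<^sup>+ v. ennreal (exp (t \<bullet> stat p v)) \<partial>pair_gauss p)"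
  by (subst nn_integral_pair_gauss(1)[OF assms]) (auto simp: inner_stat Phi_def split: prod.splits)

text \<open>Integrating over \<open>z\<close> first, the Gaussian integral turns the cross term into
  a quadratic term in \<open>y\<close>; for \<open>fst t \<ge> 1 / 2\<close> it diverges at every
  \<open>y\<close>.\<close>

lemma nn_integral_exp_stat:
  assumes "p \<ge> 2"
  shows "(\<integral>\<^sup>+ v. ennreal (exp (t \<bullet> stat p v)) \<partial>pair_gauss p) =
    (if fst t < 1 / 2 then
       ennreal (gen_gauss_const p / sqrt (1 - 2 * fst t)) *
       (\<integral>\<^sup>+ y. ennreal (exp ((fst (snd t))\<^sup>2 / (2 * (1 - 2 * fst t)) * y\<^sup>2
          - (1 / p - snd (snd t)) * \<bar>y\<bar> powr p)) \<partial>lborel)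
     else \<infinity>)"
proof -
  obtain t0 t1 t2 where t: "t = (t0, t1, t2)" by (cases t)
  have *: "(\<integral>\<^sup>+ v. ennreal (exp (t \<bullet> stat p v)) \<partial>pair_gauss p) =
    (\<integral>\<^sup>+ y. (if t0 < 1 / 2 then ennreal (exp ((t1 * y)\<^sup>2 / (2 * (1 - 2 * t0)) + t2 * \<bar>y\<bar> powr p) / sqrt (1 - 2 * t0)) else \<infinity>) \<partial>gen_gauss p)"
    by (subst nn_integral_pair_gauss(1)[OF assms], simp, unfold inner_stat t, intro nn_integral_cong,
        subst nn_integral_exp_gen_gauss_2[symmetric]) (simp add: algebra_simps)
  show ?thesis
  proof (cases "t0 < 1 / 2")
    case True
    have "(\<integral>\<^sup>+ v. ennreal (exp (t \<bullet> stat p v)) \<partial>pair_gauss p) =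
      (\<integral>\<^sup>+ y. ennreal (1 / sqrt (1 - 2 * t0)) * ennreal (exp ((t1 * y)\<^sup>2 / (2 * (1 - 2 * t0)) + t2 * \<bar>y\<bar> powr p)) \<partial>gen_gauss p)"
      using True unfolding * by (auto simp: ennreal_mult[symmetric] intro!: nn_integral_cong)
    also have "\<dots> = ennreal (1 / sqrt (1 - 2 * t0)) * (\<integral>\<^sup>+ y. ennreal (exp ((t1 * y)\<^sup>2 / (2 * (1 - 2 * t0)) + t2 * \<bar>y\<bar> powr p)) \<partial>gen_gauss p)"
      by (intro nn_integral_cmult) simp
    also have "\<dots> = ennreal (1 / sqrt (1 - 2 * t0)) * (ennreal (gen_gauss_const p)
       * (\<integral>\<^sup>+ y. ennreal (exp ((t1 * y)\<^sup>2 / (2 * (1 - 2 * t0)) + t2 * \<bar>y\<bar> powr p - \<bar>y\<bar> powr p / p)) \<partial>lborel))"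
      using assms by (subst nn_integral_exp_gen_gauss) auto
    also have "\<dots> = ennreal (gen_gauss_const p / sqrt (1 - 2 * t0))
       * (\<integral>\<^sup>+ y. ennreal (exp ((t1 * y)\<^sup>2 / (2 * (1 - 2 * t0)) + t2 * \<bar>y\<bar> powr p - \<bar>y\<bar> powr p / p)) \<partial>lborel)"
      using gen_gauss_const_pos[of p] assms True
      by (subst mult.assoc[symmetric], subst ennreal_mult[symmetric]) auto
    finally show ?thesis using True by (simp add: t algebra_simps power_mult_distrib)
  next
    case False
    interpret finite_measure "gen_gauss p" by (rule finite_gen_gauss) fact
    \<comment> \<open>Since \<open>\<infinity> * 0 = 0\<close> in \<open>ennreal\<close>, the
      constant integrand \<open>\<infinity>\<close> has infinite integral only for a measure of
      nonzero mass.\<close>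
    have "emeasure (gen_gauss p) UNIV \<noteq> 0"
    proof
      assume "emeasure (gen_gauss p) UNIV = 0"
      then have "(\<integral>\<^sup>+ y. ennreal (gen_gauss_density p y) \<partial>lborel) = 0"
        by (simp add: gen_gauss_def emeasure_density)
      then have "AE y in lborel. gen_gauss_density p y \<le> 0"
        by (subst (asm) nn_integral_0_iff_AE) (auto simp: ennreal_eq_0_iff elim!: eventually_mono)
      then have "AE y::real in lborel. False"
        by (rule AE_mp) (use gen_gauss_density_pos[of p] assms in \<open>auto simp: not_le\<close>)
      then show False by (simp add: AE_iff_null null_sets_def)
    qed
    then show ?thesis using False unfolding * by (simp add: t ennreal_top_mult)
  qed
qed

text \<open>The remaining integral over \<open>y\<close> has exponent
  \<open>A * y\<^sup>2 - b * \<bar>y\<bar> powr p\<close> with \<open>A \<ge> 0\<close>. This is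
  coercive if \<open>b > 0\<close> and, for \<open>p = 2\<close>, \<open>A < b\<close>; in all other
  cases it is nonnegative everywhere.\<close>

lemma nn_integral_exp_stat_finite_iff:
  assumes "p \<ge> 2"
  shows "(\<integral>\<^sup>+ v. ennreal (exp (t \<bullet> stat p v)) \<partial>pair_gauss p) < \<infinity> \<longleftrightarrow> t \<in> Phi_dom p"
proof (cases "fst t < 1 / 2")
  case False
  then show ?thesis by (simp add: nn_integral_exp_stat[OF assms] Phi_dom_def)
next
  case True
  define A where "A = (fst (snd t))\<^sup>2 / (2 * (1 - 2 * fst t))"
  define b where "b = 1 / p - snd (snd t)"
  have c: "gen_gauss_const p / sqrt (1 - 2 * fst t) > 0"
    using True gen_gauss_const_pos[of p] assms by simp
  have A: "A \<ge> 0" using True by (auto simp: A_def)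
  have "t \<in> Phi_dom p \<longleftrightarrow> b > 0 \<and> (p = 2 \<longrightarrow> A < b)"
    using True by (auto simp: Phi_dom_def A_def b_def field_simps)
  moreover have "(\<integral>\<^sup>+ y. ennreal (exp (A * y\<^sup>2 - b * \<bar>y\<bar> powr p)) \<partial>lborel) < \<infinity> \<longleftrightarrow> b > 0 \<and> (p = 2 \<longrightarrow> A < b)" (is "?I < _ \<longleftrightarrow> ?Q")
  proof
    assume "?Q"
    then obtain K \<eta> where *: "\<And>x::real. (\<integral>\<^sup>+ y. ennreal (exp (x * y + A * y\<^sup>2 - b * \<bar>y\<bar> powr p)) \<partial>lborel)
      \<le> ennreal (K * exp (x\<^sup>2 / (4 * \<eta>)))"
      using nn_integral_exp_powr_le[OF assms, of b A] by auto
    show "?I < \<infinity>" using order.strict_trans1[OF *[of 0] ennreal_less_top] by simp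
  next
    assume fin: "?I < \<infinity>"
    show ?Q
    proof (rule ccontr)
      assume nQ: "\<not> ?Q"
      have "A * y\<^sup>2 - b * \<bar>y\<bar> powr p \<ge> 0" for y :: real
      proof (cases "b > 0")
        case True
        with nQ have "p = 2" "b \<le> A" by auto
        then show ?thesis by (simp add: abs_powr_2 mult_right_mono)
      next
        case False
        then have "b * \<bar>y\<bar> powr p \<le> 0" by (intro mult_nonpos_nonneg) auto
        moreover have "A * y\<^sup>2 \<ge> 0" using A by simp
        ultimately show ?thesis by linarith
      qed
      then have "?I = \<infinity>"
        by (intro nn_integral_lborel_eq_infinity[where k=1 and b=0]) (auto simp: ennreal_1[symmetric] simp del: ennreal_1)
      with fin show False by simp
    qed
  qed
  ultimately show ?thesis
    unfolding nn_integral_exp_stat[OF assms] A_def[symmetric] b_def[symmetric] using True c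
    by (auto simp: ennreal_mult_less_top)
qed

lemma open_Phi_dom: "open (Phi_dom p)"
proof -
  have "open {t::real\<times>real\<times>real. fst t < 1 / 2 \<and> snd (snd t) < 1 / p}"
    by (intro open_Collect_conj open_Collect_less continuous_intros)
  moreover have "open {t::real\<times>real\<times>real. fst t < 1 / 2 \<and> snd (snd t) < 1 / p \<and>
     (fst (snd t))\<^sup>2 < (1 - 2 * fst t) * (1 - 2 * snd (snd t))}"
    by (intro open_Collect_conj open_Collect_less continuous_intros)
  ultimately show ?thesis by (cases "p = 2") (auto simp: Phi_dom_def)
qed

section \<open>The finite values of \<open>Lambda\<close>, their growth and their averages\<close>

definition lam :: "real \<Rightarrow> real \<Rightarrow> real \<Rightarrow> real" where
  "lam p t2 x = ln (enn2real (\<integral>\<^sup>+ y. ennreal (exp (x * y + t2 * \<bar>y\<bar> powr p)) \<partial>gen_gauss p))"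

lemma measurable_lam[measurable]: "lam p t2 \<in> borel_measurable borel" if "p \<ge> 2"
proof -
  interpret finite_measure "gen_gauss p" by (rule finite_gen_gauss) fact
  show ?thesis unfolding lam_def[abs_def] by measurable
qed

text \<open>The first claim shows that the truncation in \<open>lam\<close> is harmless for
  \<open>t2 < 1 / p\<close>. For the second, coercivity bounds the integral from above, and
  \<open>x * y \<ge> - x\<^sup>2 / 2 - y\<^sup>2 / 2\<close> separates the variables below.
  Quadratic growth makes \<open>lam\<close> integrable under finite second moments.\<close>

lemma lam_bounds:
  assumes p: "p \<ge> 2" and t2: "t2 < 1 / p"
  shows "ennreal (exp (lam p t2 x)) = (\<integral>\<^sup>+ y. ennreal (exp (x * y + t2 * \<bar>y\<bar> powr p)) \<partial>gen_gauss p)" (is "_ = ?I x")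
    and "\<exists>C. \<forall>x. \<bar>lam p t2 x\<bar> \<le> C * (1 + x\<^sup>2)"
proof -
  have c: "gen_gauss_const p > 0" using p by (simp add: gen_gauss_const_pos)
  have I: "?I x = ennreal (gen_gauss_const p) * (\<integral>\<^sup>+ y. ennreal (exp (x * y + 0 * y\<^sup>2 - (1 / p - t2) * \<bar>y\<bar> powr p)) \<partial>lborel)" for x
    using p by (subst nn_integral_exp_gen_gauss) (auto simp: algebra_simps)
  have b0: "0 < 1 / p - t2" using t2 by simp
  obtain K \<eta> where K: "K > 0" "\<eta> > 0" and K': "\<And>x::real. (\<integral>\<^sup>+ y. ennreal (exp (x * y + 0 * y\<^sup>2 - (1 / p - t2) * \<bar>y\<bar> powr p)) \<partial>lborel)
      \<le> ennreal (K * exp (x\<^sup>2 / (4 * \<eta>)))"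
    using nn_integral_exp_powr_le[OF p b0 b0] by blast
  define K2 where "K2 = gen_gauss_const p * K"
  have K2: "K2 > 0" using K c by (simp add: K2_def)
  have up: "?I x \<le> ennreal (K2 * exp (x\<^sup>2 / (4 * \<eta>)))" for x
    unfolding I K2_def mult.assoc using K c by (subst ennreal_mult) (simp, simp, intro mult_left_mono K', simp)
  \<comment> \<open>The factor of the lower bound that does not involve \<open>x\<close>; it must be
    nonzero for its logarithm to be a usable constant.\<close>
  define J where "J = (\<integral>\<^sup>+ y. ennreal (exp (- (y\<^sup>2 / 2) + t2 * \<bar>y\<bar> powr p)) \<partial>gen_gauss p)"
  have low: "ennreal (exp (- (x\<^sup>2 / 2))) * J \<le> ?I x" for x
  proof -
    have "ennreal (exp (- (x\<^sup>2 / 2))) * J = (\<integral>\<^sup>+ y. ennreal (exp (- (x\<^sup>2 / 2))) * ennreal (exp (- (y\<^sup>2 / 2) + t2 * \<bar>y\<bar> powr p)) \<partial>gen_gauss p)"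
      unfolding J_def by (intro nn_integral_cmult[symmetric]) simp
    also have "\<dots> \<le> ?I x"
    proof (rule nn_integral_mono)
      fix y :: real
      have "- (x\<^sup>2 / 2) - y\<^sup>2 / 2 \<le> x * y"
        using zero_le_power2[of "x + y"] by (simp add: power2_sum field_simps)
      then show "ennreal (exp (- (x\<^sup>2 / 2))) * ennreal (exp (- (y\<^sup>2 / 2) + t2 * \<bar>y\<bar> powr p)) \<le> ennreal (exp (x * y + t2 * \<bar>y\<bar> powr p))"
        by (simp add: ennreal_mult[symmetric] exp_add[symmetric])
    qed
    finally show ?thesis .
  qed
  have "J \<noteq> 0"
  proof
    assume "J = 0"
    moreover have "J = ennreal (gen_gauss_const p) * (\<integral>\<^sup>+ y. ennreal (exp (- (y\<^sup>2 / 2) + t2 * \<bar>y\<bar> powr p - \<bar>y\<bar> powr p / p)) \<partial>lborel)"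
      unfolding J_def using p by (intro nn_integral_exp_gen_gauss) auto
    ultimately have "(\<integral>\<^sup>+ y. ennreal (exp (- (y\<^sup>2 / 2) + t2 * \<bar>y\<bar> powr p - \<bar>y\<bar> powr p / p)) \<partial>lborel) = 0"
      using c by auto
    then have "AE y::real in lborel. False"
      by (subst (asm) nn_integral_0_iff_AE) (auto simp: not_le)
    then show False by (simp add: AE_iff_null null_sets_def)
  qed
  moreover have "J < \<infinity>" using order.strict_trans1[OF order_trans[OF low up] ennreal_less_top, of 0] by simp
  ultimately obtain j where j: "j > 0" "J = ennreal j" by (cases J) auto
  have I_real: "\<exists>r. ?I x = ennreal r \<and> r > 0 \<and> r \<le> K2 * exp (x\<^sup>2 / (4 * \<eta>)) \<and> exp (- (x\<^sup>2 / 2)) * j \<le> r" for x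
  proof -
    have l: "ennreal (exp (- (x\<^sup>2 / 2)) * j) \<le> ?I x" using low[of x] j by (simp add: ennreal_mult)
    have "?I x < \<infinity>" using order.strict_trans1[OF up ennreal_less_top] by simp
    then obtain r where r: "?I x = ennreal r" "r \<ge> 0" by (cases "?I x") auto
    have "exp (- (x\<^sup>2 / 2)) * j \<le> r" using l r by simp
    moreover have "exp (- (x\<^sup>2 / 2)) * j > 0" using j by simp
    moreover have "r \<le> K2 * exp (x\<^sup>2 / (4 * \<eta>))" using up[of x] r K2 by simp
    ultimately show ?thesis using r by (intro exI[of _ r]) auto
  qed
  have el: "?I x = ennreal (exp (lam p t2 x)) \<and> exp (lam p t2 x) \<le> K2 * exp (x\<^sup>2 / (4 * \<eta>)) \<and> exp (- (x\<^sup>2 / 2)) * j \<le> exp (lam p t2 x)" for x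
    using I_real[of x] by (auto simp: lam_def)
  then show "ennreal (exp (lam p t2 x)) = ?I x" by simp
  show "\<exists>C. \<forall>x. \<bar>lam p t2 x\<bar> \<le> C * (1 + x\<^sup>2)"
  proof (intro exI allI)
    fix x
    have "lam p t2 x \<le> ln (K2 * exp (x\<^sup>2 / (4 * \<eta>)))"
      using el[of x] K2 by (subst ln_ge_iff) auto
    then have 1: "lam p t2 x \<le> ln K2 + x\<^sup>2 / (4 * \<eta>)" using K2 by (simp add: ln_mult)
    have "ln (exp (- (x\<^sup>2 / 2)) * j) \<le> ln (exp (lam p t2 x))"
      using el[of x] j by (subst ln_le_cancel_iff) auto
    then have 2: "- (x\<^sup>2 / 2) + ln j \<le> lam p t2 x" using j by (simp add: ln_mult)
    have "x\<^sup>2 / (4 * \<eta>) \<ge> 0" using K by simp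
    then have "\<bar>lam p t2 x\<bar> \<le> (\<bar>ln K2\<bar> + \<bar>ln j\<bar>) + x\<^sup>2 / (4 * \<eta>) + x\<^sup>2 / 2"
      using 1 2 zero_le_power2[of x] abs_ge_self[of "ln K2"] abs_ge_zero[of "ln K2"]
        abs_ge_minus_self[of "ln j"] abs_ge_zero[of "ln j"]
      by (intro abs_leI) linarith+
    also have "\<dots> \<le> (\<bar>ln K2\<bar> + \<bar>ln j\<bar> + 1 / (4 * \<eta>) + 1 / 2) * (1 + x\<^sup>2)"
    proof -
      define q where "q = 1 / (4 * \<eta>)"
      have "q \<ge> 0" "x\<^sup>2 / (4 * \<eta>) = q * x\<^sup>2" using K by (auto simp: q_def)
      then show ?thesis unfolding q_def[symmetric] by (simp add: algebra_simps add_nonneg_nonneg)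
    qed
    finally show "\<bar>lam p t2 x\<bar> \<le> (\<bar>ln K2\<bar> + \<bar>ln j\<bar> + 1 / (4 * \<eta>) + 1 / 2) * (1 + x\<^sup>2)" .
  qed
qed

lemma Lambda_eq:
  assumes p: "p \<ge> 2"
  shows "Lambda p (x, t2) = (if t2 < 1 / p then ereal (lam p t2 x) else \<infinity>)"
proof (cases "t2 < 1 / p")
  case True
  then show ?thesis
    unfolding Lambda_def using lam_bounds(1)[OF p True, of x, symmetric] by (simp add: ln_ennreal_def)
next
  case False
  have "(\<integral>\<^sup>+ y. ennreal (exp (x * y + t2 * \<bar>y\<bar> powr p - \<bar>y\<bar> powr p / p)) \<partial>lborel) = \<infinity>"
  proof (rule nn_integral_lborel_eq_infinity[where k=1 and b=x])
    fix y assume "x * y \<ge> 0"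
    moreover have "(t2 - 1 / p) * \<bar>y\<bar> powr p \<ge> 0" using False by (intro mult_nonneg_nonneg) auto
    ultimately have "x * y + t2 * \<bar>y\<bar> powr p - \<bar>y\<bar> powr p / p \<ge> 0" by (simp add: algebra_simps)
    then show "ennreal 1 \<le> ennreal (exp (x * y + t2 * \<bar>y\<bar> powr p - \<bar>y\<bar> powr p / p))"
      by (intro ennreal_leI) simp
  qed simp
  then have "(\<integral>\<^sup>+ y. ennreal (exp (x * y + t2 * \<bar>y\<bar> powr p)) \<partial>gen_gauss p) = \<infinity>"
    using p gen_gauss_const_pos[of p] by (subst nn_integral_exp_gen_gauss) (auto simp: ennreal_mult_top)
  then show ?thesis using False by (simp add: Lambda_def ln_ennreal_def)
qed

lemma integrable_lam:
  assumes p: "p \<ge> 2" and t2: "t2 < 1 / p" and "real_distribution \<nu>" and i: "integrable \<nu> (\<lambda>u. u\<^sup>2)"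
  shows "integrable \<nu> (\<lambda>u. lam p t2 (t1 * u))"
proof -
  interpret real_distribution \<nu> by fact
  obtain C where C: "\<And>x. \<bar>lam p t2 x\<bar> \<le> C * (1 + x\<^sup>2)" using lam_bounds(2)[OF p t2] by blast
  show ?thesis
  proof (rule Bochner_Integration.integrable_bound)
    show "integrable \<nu> (\<lambda>u. C * (1 + t1\<^sup>2 * u\<^sup>2))" using i by simp
    show "(\<lambda>u. lam p t2 (t1 * u)) \<in> borel_measurable \<nu>" using measurable_lam[OF p, measurable] by simp
    show "AE u in \<nu>. norm (lam p t2 (t1 * u)) \<le> norm (C * (1 + t1\<^sup>2 * u\<^sup>2))"
      using C[of "t1 * _"] by (intro AE_I2) (auto simp: power_mult_distrib intro: order_trans[OF _ abs_ge_self])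
  qed
qed

lemma Psi_eq:
  assumes p: "p \<ge> 2" and "real_distribution \<nu>" and i: "integrable \<nu> (\<lambda>u. u\<^sup>2)"
  shows "Psi p \<nu> (t1, t2) = (if t2 < 1 / p then ereal (\<integral>u. lam p t2 (t1 * u) \<partial>\<nu>) else \<infinity>)"
proof -
  interpret real_distribution \<nu> by fact
  show ?thesis
    unfolding Psi_def using ereal_integral_eq_integral[OF integrable_lam[OF p _ assms(2) i]]
    emeasure_space_1
    by (auto simp: Lambda_eq[OF p] ereal_integral_def e2ennreal_neg)
qed

section \<open>Scaling, infinite values and weak duality\<close>

lemma ln_ennreal_ennreal: "r > 0 \<Longrightarrow> ln_ennreal (ennreal r) = ereal (ln r)"
  by (simp add: ln_ennreal_def)

lemma ln_ennreal_le:
  assumes "x \<le> ennreal (exp r)"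
  shows "ln_ennreal x \<le> ereal r"
proof (cases x)
  case (real y)
  show ?thesis
  proof (cases "y = 0")
    case False
    then have "y > 0" "y \<le> exp r" using real assms by auto
    then have "ln y \<le> r" by (metis exp_gt_zero ln_exp ln_le_cancel_iff)
    then show ?thesis using real \<open>y > 0\<close> by (simp add: ln_ennreal_ennreal)
  qed (use real in \<open>simp add: ln_ennreal_def\<close>)
next
  case top
  then show ?thesis using assms by (simp add: top_unique)
qed

lemma ln_ennreal_mult:
  assumes "c > 0"
  shows "ln_ennreal (ennreal c * x) = ereal (ln c) + ln_ennreal x"
proof (cases x)
  case (real y)
  then show ?thesis using assms
    by (cases "y = 0") (auto simp: ln_ennreal_def ennreal_mult[symmetric] ln_mult enn2real_mult)
next
  case top
  then show ?thesis using assms by (simp add: ln_ennreal_def ennreal_mult_top)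
qed

text \<open>Substitute \<open>sqrt \<tau>0 * z\<close> for \<open>z\<close>. The Jacobian adds
  \<open>ln (sqrt \<tau>0)\<close> to \<open>Phi\<close>, while the linear term gains
  \<open>(\<tau>0 - 1) / 2\<close>, which is at least as much by
  \<open>ln x \<le> x - 1\<close>.\<close>

lemma legendre_Phi_scale:
  assumes p: "p \<ge> 2" and \<tau>0: "\<tau>0 > 0"
  shows "legendre (Phi p) (1, \<tau>1 / sqrt \<tau>0, \<tau>2) \<le> legendre (Phi p) (\<tau>0, \<tau>1, \<tau>2)"
  unfolding legendre_def
proof (rule SUP_mono)
  fix t :: "real \<times> real \<times> real"
  obtain t0 t1 t2 where t: "t = (t0, t1, t2)" by (cases t)
  show "\<exists>t'\<in>UNIV. ereal (t \<bullet> (1, \<tau>1 / sqrt \<tau>0, \<tau>2)) - Phi p t \<le> ereal (t' \<bullet> (\<tau>0, \<tau>1, \<tau>2)) - Phi p t'"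
  proof (cases "t0 < 1 / 2")
    case False
    then have "Phi p t = \<infinity>" by (simp add: Phi_eq[OF p] nn_integral_exp_stat[OF p] t ln_ennreal_def)
    then show ?thesis by simp
  next
    case True
    \<comment> \<open>With the Gaussian weight included, \<open>- z\<^sup>2\<close> has coefficient
      \<open>1 / 2 - t0\<close>, which the substitution divides by \<open>\<tau>0\<close>; dividing
      \<open>t1\<close> by \<open>sqrt \<tau>0\<close> preserves the induced quadratic term in
      \<open>y\<close>.\<close>
    define t' where "t' = (1 / 2 - (1 / 2 - t0) / \<tau>0, t1 / sqrt \<tau>0, t2)"
    have 1: "1 - 2 * fst t' = (1 - 2 * t0) / \<tau>0" using \<tau>0 by (simp add: t'_def field_simps)
    have lt: "fst t' < 1 / 2" using True \<tau>0 by (simp add: t'_def)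
    have s: "sqrt \<tau>0 > 0" "(sqrt \<tau>0)\<^sup>2 = \<tau>0" using \<tau>0 by auto
    have 2: "(fst (snd t'))\<^sup>2 / (2 * (1 - 2 * fst t')) = t1\<^sup>2 / (2 * (1 - 2 * t0))"
      unfolding 1 using \<tau>0 s by (simp add: t'_def power_divide)
    have 3: "gen_gauss_const p / sqrt (1 - 2 * fst t') = sqrt \<tau>0 * (gen_gauss_const p / sqrt (1 - 2 * t0))"
      unfolding 1 using \<tau>0 s by (simp add: real_sqrt_divide)
    have "Phi p t' = ereal (ln (sqrt \<tau>0)) + Phi p t"
      unfolding Phi_eq[OF p] nn_integral_exp_stat[OF p] 2 3 using lt True s gen_gauss_const_pos[of p] p
      by (subst ln_ennreal_mult[symmetric])
         (simp_all add: t t'_def ennreal_mult mult.assoc del: times_divide_eq_right)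
    moreover have "t \<bullet> (1, \<tau>1 / sqrt \<tau>0, \<tau>2) + ln (sqrt \<tau>0) \<le> t' \<bullet> (\<tau>0, \<tau>1, \<tau>2)"
    proof -
      have "ln (sqrt \<tau>0) \<le> (\<tau>0 - 1) / 2"
        using ln_le_minus_one[OF \<tau>0] \<tau>0 by (simp add: ln_sqrt)
      moreover have "t' \<bullet> (\<tau>0, \<tau>1, \<tau>2) = t \<bullet> (1, \<tau>1 / sqrt \<tau>0, \<tau>2) + (\<tau>0 - 1) / 2"
        using \<tau>0 by (simp add: t t'_def field_simps)
      ultimately show ?thesis by simp
    qed
    ultimately have "ereal (t \<bullet> (1, \<tau>1 / sqrt \<tau>0, \<tau>2)) - Phi p t \<le> ereal (t' \<bullet> (\<tau>0, \<tau>1, \<tau>2)) - Phi p t'"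
      by (cases "Phi p t") auto
    then show ?thesis by blast
  qed
qed

text \<open>Along a ray of outer normals the linear term is at least \<open>D\<close>, whereas the
  Gaussian integral over \<open>z\<close> pushes \<open>Phi\<close> below \<open>D\<close> by
  \<open>ln (1 + l) / 2\<close> up to a constant. The difference is unbounded in
  \<open>l\<close>.\<close>

lemma legendre_Phi_eq_infinity:
  assumes p: "p \<ge> 2" and \<tau>2: "\<tau>2 > 0" and \<tau>1: "\<bar>\<tau>1\<bar> \<ge> \<tau>2 powr (1 / p)"
  shows "legendre (Phi p) (1, \<tau>1, \<tau>2) = \<infinity>"
proof -
  interpret finite_measure "gen_gauss p" by (rule finite_gen_gauss) fact
  define s where "s = \<tau>2 powr (1 / p)"
  have s: "s > 0" "s powr p = \<tau>2" using \<tau>2 p by (auto simp: s_def powr_powr)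
  define \<sigma> where "\<sigma> = sgn \<tau>1"
  have \<sigma>: "\<sigma> * \<tau>1 = \<bar>\<tau>1\<bar>" "\<sigma>\<^sup>2 = 1" using \<tau>1 s by (auto simp: \<sigma>_def sgn_if s_def)
  \<comment> \<open>Adding 1 makes \<open>m\<close> positive without any lower bound on the total
    mass, so that \<open>exp (ln m) = m\<close>.\<close>
  define m where "m = measure (gen_gauss p) UNIV + 1"
  have m: "m > 0" "emeasure (gen_gauss p) UNIV \<le> ennreal m"
    by (auto simp: m_def emeasure_eq_measure add_nonneg_pos intro: ennreal_leI)
  \<comment> \<open>After scaling by \<open>s\<close>, this is Young's inequality for
    \<open>r powr p\<close> and 1 with weights \<open>2 / p\<close> and
    \<open>1 - 2 / p\<close>.\<close>
  have young: "y\<^sup>2 / (2 * s\<^sup>2) - \<bar>y\<bar> powr p / (p * \<tau>2) \<le> 1 / 2 - 1 / p" for y :: real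
  proof -
    define r where "r = \<bar>y\<bar> / s"
    have r: "r \<ge> 0" using s by (simp add: r_def)
    have "r\<^sup>2 / 2 - r powr p / p \<le> 1 / 2 - 1 / p"
    proof (cases "r = 0")
      case False
      have "(r powr p) powr (2 / p) * 1 powr (1 - 2 / p) \<le> (2 / p) * r powr p + (1 - 2 / p) * 1"
        using p r False by (intro Youngs_inequality_0) auto
      moreover have "(r powr p) powr (2 / p) = r\<^sup>2"
        using p r False by (simp add: powr_powr powr_numeral)
      moreover have "(2 / p) * r powr p = 2 * (r powr p / p)" "(1 - 2 / p) * 1 = 1 - 2 * (1 / p)" by simp_all
      ultimately show ?thesis by simp
    qed (use p in \<open>simp add: field_simps\<close>)
    moreover have "r\<^sup>2 = y\<^sup>2 / s\<^sup>2" by (simp add: r_def power_divide)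
    moreover have "r powr p = \<bar>y\<bar> powr p / \<tau>2" using s by (simp add: r_def powr_divide)
    ultimately show ?thesis by (simp add: mult.commute)
  qed
  have main: "ereal (ln (1 + l) / 2 - ln m) \<le> legendre (Phi p) (1, \<tau>1, \<tau>2)" if l: "l > 0" for l
  proof -
    \<comment> \<open>The outer normal, scaled by \<open>l\<close>, of a half-space that contains the range of \<open>stat p\<close>,
      but not \<open>(1, \<tau>1, \<tau>2)\<close> in its interior; it touches the range only on the null set
      \<open>z = \<sigma> * y / s\<close>. This is where \<open>p \<ge> 2\<close> matters.\<close>
    define t where "t = (- (l / 2), l * \<sigma> / s, - (l / (p * \<tau>2)))"
    define D where "D = l * (1 / 2 - 1 / p)"
    have inner: "(\<integral>\<^sup>+ z. ennreal (exp (t \<bullet> stat p (y, z))) \<partial>gen_gauss 2) \<le> ennreal (exp D / sqrt (1 + l))" for y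
    proof -
      have "(\<integral>\<^sup>+ z. ennreal (exp (t \<bullet> stat p (y, z))) \<partial>gen_gauss 2)
        = (\<integral>\<^sup>+ z. ennreal (exp (- (l / 2) * z\<^sup>2 + (l * \<sigma> * y / s) * z + - (l / (p * \<tau>2)) * \<bar>y\<bar> powr p)) \<partial>gen_gauss 2)"
        unfolding inner_stat t_def by (simp add: algebra_simps)
      also have "\<dots> = ennreal (exp ((l * \<sigma> * y / s)\<^sup>2 / (2 * (1 + l)) + - (l / (p * \<tau>2)) * \<bar>y\<bar> powr p) / sqrt (1 + l))"
        unfolding nn_integral_exp_gen_gauss_2 using l by simp
      also have "\<dots> \<le> ennreal (exp D / sqrt (1 + l))"
      proof (intro ennreal_leI divide_right_mono exp_le_cancel_iff[THEN iffD2])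
        have "(l * \<sigma> * y / s)\<^sup>2 / (2 * (1 + l)) = l * (y\<^sup>2 / (2 * s\<^sup>2)) * (l / (1 + l))"
          using \<sigma>(2) s l by (simp add: power_mult_distrib power_divide field_simps power2_eq_square[of l])
        also have "\<dots> \<le> l * (y\<^sup>2 / (2 * s\<^sup>2)) * 1"
          using l by (intro mult_left_mono) auto
        finally have "(l * \<sigma> * y / s)\<^sup>2 / (2 * (1 + l)) + - (l / (p * \<tau>2)) * \<bar>y\<bar> powr p
          \<le> l * (y\<^sup>2 / (2 * s\<^sup>2) - \<bar>y\<bar> powr p / (p * \<tau>2))"
          by (simp add: algebra_simps)
        also have "\<dots> \<le> D" unfolding D_def using l by (intro mult_left_mono young) auto
        finally show "(l * \<sigma> * y / s)\<^sup>2 / (2 * (1 + l)) + - (l / (p * \<tau>2)) * \<bar>y\<bar> powr p \<le> D" .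
      qed (use l in simp)
      finally show ?thesis .
    qed
    have "(\<integral>\<^sup>+ v. ennreal (exp (t \<bullet> stat p v)) \<partial>pair_gauss p)
      \<le> (\<integral>\<^sup>+ y. ennreal (exp D / sqrt (1 + l)) \<partial>gen_gauss p)"
      by (subst nn_integral_pair_gauss(1)[OF p]) (simp, intro nn_integral_mono inner)
    also have "\<dots> \<le> ennreal (exp D / sqrt (1 + l)) * ennreal m"
      using m(2) by (simp add: mult_left_mono)
    also have "\<dots> = ennreal (exp (D - ln (1 + l) / 2 + ln m))"
      using m l by (simp add: ennreal_mult[symmetric] exp_add exp_diff ln_sqrt[symmetric])
    finally have "Phi p t \<le> ereal (D - ln (1 + l) / 2 + ln m)"
      unfolding Phi_eq[OF p] by (rule ln_ennreal_le)
    moreover have "t \<bullet> (1, \<tau>1, \<tau>2) \<ge> D"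
    proof -
      have "t \<bullet> (1, \<tau>1, \<tau>2) = l * (\<bar>\<tau>1\<bar> / s - 1 / 2 - 1 / p)"
        using \<tau>2 \<sigma>(1) p by (simp add: t_def field_simps)
      moreover have "\<bar>\<tau>1\<bar> / s \<ge> 1" using \<tau>1 s by (simp add: s_def)
      ultimately show ?thesis unfolding D_def using l by simp
    qed
    ultimately have "ereal (ln (1 + l) / 2 - ln m) \<le> ereal (t \<bullet> (1, \<tau>1, \<tau>2)) - Phi p t"
      by (cases "Phi p t") auto
    also have "\<dots> \<le> legendre (Phi p) (1, \<tau>1, \<tau>2)" unfolding legendre_def by (rule SUP_upper) simp
    finally show ?thesis .
  qed
  show ?thesis
  proof (rule ereal_top)
    fix B
    have "ereal B \<le> ereal (ln (1 + exp (2 * (\<bar>B\<bar> + ln m))) / 2 - ln m)"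
    proof -
      have "2 * (\<bar>B\<bar> + ln m) \<le> ln (1 + exp (2 * (\<bar>B\<bar> + ln m)))"
        by (subst ln_ge_iff) (auto simp: add_pos_pos)
      then show ?thesis by simp
    qed
    also have "\<dots> \<le> legendre (Phi p) (1, \<tau>1, \<tau>2)" by (rule main) simp
    finally show "ereal B \<le> legendre (Phi p) (1, \<tau>1, \<tau>2)" .
  qed
qed

section \<open>The Gibbs inequality and weak duality\<close>

lemma nn_integral_exp_stat_eq_lam:
  assumes p: "p \<ge> 2" and t2: "t2 < 1 / p"
  shows "(\<integral>\<^sup>+ v. ennreal (exp ((t0, t1, t2) \<bullet> stat p v)) \<partial>pair_gauss p)
    = (\<integral>\<^sup>+ z. ennreal (exp (t0 * z\<^sup>2 + lam p t2 (t1 * z))) \<partial>gen_gauss 2)"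
proof -
  \<comment> \<open>Integrating over \<open>y\<close> first, with \<open>z\<close> frozen, produces
    the conditional exponential moment; this is where the quenched function enters the annealed
    integral.\<close>
  have "(\<integral>\<^sup>+ y. ennreal (exp ((t0, t1, t2) \<bullet> stat p (y, z))) \<partial>gen_gauss p)
    = ennreal (exp (t0 * z\<^sup>2 + lam p t2 (t1 * z)))" for z
  proof -
    have "(\<integral>\<^sup>+ y. ennreal (exp ((t0, t1, t2) \<bullet> stat p (y, z))) \<partial>gen_gauss p)
      = (\<integral>\<^sup>+ y. ennreal (exp (t0 * z\<^sup>2)) * ennreal (exp ((t1 * z) * y + t2 * \<bar>y\<bar> powr p)) \<partial>gen_gauss p)"
      by (simp add: inner_stat ennreal_mult[symmetric] exp_add[symmetric] add.assoc)
    also have "\<dots> = ennreal (exp (t0 * z\<^sup>2)) * ennreal (exp (lam p t2 (t1 * z)))"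
      unfolding lam_bounds(1)[OF p t2] by (intro nn_integral_cmult) simp
    finally show ?thesis by (simp add: ennreal_mult[symmetric] exp_add)
  qed
  then show ?thesis by (subst nn_integral_pair_gauss(2)[OF p]) simp_all
qed

lemma Phi_finite:
  assumes p: "p \<ge> 2" and t: "t \<in> Phi_dom p"
  obtains \<phi> where "Phi p t = ereal \<phi>"
    "(\<integral>\<^sup>+ v. ennreal (exp (t \<bullet> stat p v)) \<partial>pair_gauss p) = ennreal (exp \<phi>)"
proof -
  interpret prob_space "gen_gauss 2" by (rule prob_space_gen_gauss_2)
  note [measurable] = measurable_lam[OF p]
  let ?I = "\<integral>\<^sup>+ v. ennreal (exp (t \<bullet> stat p v)) \<partial>pair_gauss p"
  obtain t0 t1 t2 where t_eq: "t = (t0, t1, t2)" by (cases t)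
  have t2: "t2 < 1 / p" using t by (simp add: t_eq Phi_dom_def)
  have fin: "?I < \<infinity>" using nn_integral_exp_stat_finite_iff[OF p] t by simp
  have "?I \<noteq> 0"
  proof
    assume "?I = 0"
    then have "AE z in gen_gauss 2. False"
      unfolding t_eq nn_integral_exp_stat_eq_lam[OF p t2]
      by (subst (asm) nn_integral_0_iff_AE) (auto simp: not_le)
    then show False by simp
  qed
  with fin obtain r where r: "r > 0" "?I = ennreal r" by (cases ?I) auto
  show ?thesis
    by (rule that[of "ln r"]) (use r in \<open>auto simp: Phi_eq[OF p] ln_ennreal_ennreal\<close>)
qed

lemma Phi_infinite:
  assumes p: "p \<ge> 2" and t: "t \<notin> Phi_dom p"
  shows "Phi p t = \<infinity>"
  using nn_integral_exp_stat_finite_iff[OF p, of t] t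
  by (simp add: Phi_eq[OF p] ln_ennreal_def not_less top_unique)

text \<open>The Gibbs (Donsker-Varadhan) inequality. With \<open>h\<close> the log-density,
  \<open>g - h\<close> has exponential moment at most one under \<open>\<nu>\<close>, since the
  density cancels \<open>exp (- h)\<close>; Jensen's inequality then compares the integrals.\<close>

lemma integral_le_rel_entropy:
  assumes \<nu>: "real_distribution \<nu>" and "prob_space \<mu>" and s[measurable_cong]: "sets \<mu> = sets borel"
    and g: "integrable \<nu> g" and le: "(\<integral>\<^sup>+ x. ennreal (exp (g x)) \<partial>\<mu>) \<le> 1"
  shows "ereal (integral\<^sup>L \<nu> g) \<le> rel_entropy \<nu> \<mu>"
proof (cases "absolutely_continuous \<mu> \<nu>")
  case False
  then show ?thesis by (simp add: rel_entropy_def)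
next
  case True
  interpret N: real_distribution \<nu> by fact
  interpret M: prob_space \<mu> by fact
  define \<rho> where "\<rho> = RN_deriv \<mu> \<nu>"
  define h where "h = entropy_density (exp 1) \<mu> \<nu>"
  have gm[measurable]: "g \<in> borel_measurable borel" using g by (auto dest: borel_measurable_integrable)
  have [measurable]: "\<rho> \<in> borel_measurable borel"
    using borel_measurable_RN_deriv[of \<mu> \<nu>] s measurable_cong_sets[OF s refl] by (auto simp: \<rho>_def)
  have h_eq: "h x = ln (enn2real (\<rho> x))" for x
    by (simp add: h_def entropy_density_def \<rho>_def log_def)
  then have hm[measurable]: "h \<in> borel_measurable borel" unfolding h_eq[abs_def] by measurable
  have dens: "density \<mu> \<rho> = \<nu>" unfolding \<rho>_def
    using True s by (intro M.density_RN_deriv) auto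
  have fin: "AE x in \<mu>. \<rho> x \<noteq> \<infinity>" unfolding \<rho>_def
    using True s by (intro M.RN_deriv_finite) (auto intro: N.sigma_finite_measure_axioms)
  have "(\<integral>\<^sup>+ x. ennreal (exp (g x - h x)) \<partial>\<nu>) = (\<integral>\<^sup>+ x. \<rho> x * ennreal (exp (g x - h x)) \<partial>\<mu>)"
    by (subst dens[symmetric], subst nn_integral_density) auto
  also have "\<dots> \<le> (\<integral>\<^sup>+ x. ennreal (exp (g x)) \<partial>\<mu>)"
  proof (rule nn_integral_mono_AE, rule AE_mp[OF fin], intro AE_I2 impI)
    fix x assume "\<rho> x \<noteq> \<infinity>"
    then obtain r where r: "\<rho> x = ennreal r" "r \<ge> 0" by (cases "\<rho> x") auto
    \<comment> \<open>Where the density vanishes the left side is 0, whatever \<open>h x\<close> is;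
      hence an inequality rather than an equality.\<close>
    show "\<rho> x * ennreal (exp (g x - h x)) \<le> ennreal (exp (g x))"
      using r by (cases "r = 0") (auto simp: h_eq exp_diff ennreal_mult[symmetric])
  qed
  finally have e: "(\<integral>\<^sup>+ x. ennreal (exp (g x - h x)) \<partial>\<nu>) \<le> 1" using le by simp
  \<comment> \<open>The negative part of \<open>h\<close> has finite integral, so the entropy is
    never an indeterminate difference: it is \<open>\<infinity>\<close> or a Bochner
    integral.\<close>
  have "(\<integral>\<^sup>+ x. ennreal (- h x) \<partial>\<nu>) \<le> (\<integral>\<^sup>+ x. ennreal (exp (g x - h x)) + ennreal \<bar>g x\<bar> \<partial>\<nu>)"
  proof (rule nn_integral_mono)
    fix x
    have "- h x \<le> exp (g x - h x) + \<bar>g x\<bar>" using exp_ge_add_one_self[of "g x - h x"] by linarith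
    then show "ennreal (- h x) \<le> ennreal (exp (g x - h x)) + ennreal \<bar>g x\<bar>"
      by (simp add: ennreal_plus[symmetric] ennreal_leI del: ennreal_plus)
  qed
  also have "\<dots> = (\<integral>\<^sup>+ x. ennreal (exp (g x - h x)) \<partial>\<nu>) + (\<integral>\<^sup>+ x. ennreal \<bar>g x\<bar> \<partial>\<nu>)"
    by (intro nn_integral_add) auto
  also have "\<dots> < \<infinity>"
    using e g by (auto simp: integrable_iff_bounded le_less_trans[OF e])
  finally have neg: "(\<integral>\<^sup>+ x. ennreal (- h x) \<partial>\<nu>) < \<infinity>" .
  have re: "rel_entropy \<nu> \<mu> = ereal_integral \<nu> (\<lambda>x. ereal (h x))"
    using True by (simp add: rel_entropy_def h_def)
  show ?thesis
  proof (cases "(\<integral>\<^sup>+ x. ennreal (h x) \<partial>\<nu>) < \<infinity>")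
    case False
    then have "(\<integral>\<^sup>+ x. ennreal (h x) \<partial>\<nu>) = \<infinity>" by (simp add: not_less top_unique)
    then have "rel_entropy \<nu> \<mu> = \<infinity>"
      unfolding re ereal_integral_def using neg
      by (cases "\<integral>\<^sup>+ x. ennreal (- h x) \<partial>\<nu>") (auto simp: enn2ereal_ennreal)
    then show ?thesis by simp
  next
    case fin': True
    have hi: "integrable \<nu> h" using neg fin' by (auto simp: real_integrable_def)
    have "integral\<^sup>L \<nu> (\<lambda>x. g x - h x) \<le> 0"
      using g hi e by (intro integral_nonpos_of_exp N.prob_space_axioms) auto
    then show ?thesis unfolding re ereal_integral_eq_integral[OF hi] using g hi by simp
  qed
qed

lemma moment_2_eq:
  assumes \<nu>: "real_distribution \<nu>" and le: "moment 2 \<nu> < \<infinity>"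
  shows "integrable \<nu> (\<lambda>u. u\<^sup>2)" "moment 2 \<nu> = ennreal (\<integral>u. u\<^sup>2 \<partial>\<nu>)"
proof -
  interpret real_distribution \<nu> by fact
  show i: "integrable \<nu> (\<lambda>u. u\<^sup>2)"
    unfolding integrable_iff_bounded using le by (simp add: moment_def abs_powr_2)
  show "moment 2 \<nu> = ennreal (\<integral>u. u\<^sup>2 \<partial>\<nu>)"
    unfolding moment_def abs_powr_2 by (rule nn_integral_eq_integral[OF i]) simp
qed

text \<open>The Gibbs inequality is applied to
  \<open>t0 * z\<^sup>2 + lam p t2 (t1 * z) - \<phi>\<close>, whose exponential moment is one
  because \<open>\<phi>\<close> is the value of \<open>Phi\<close>. Outside \<open>Phi_dom\<close>
  the term of the supremum is \<open>- \<infinity>\<close>.\<close>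

lemma legendre_Phi_le:
  assumes p: "p \<ge> 2" and \<nu>: "real_distribution \<nu>" and m: "moment 2 \<nu> \<le> 1"
  shows "legendre (Phi p) (1, \<tau>1, \<tau>2) \<le> legendre (Psi p \<nu>) (\<tau>1, \<tau>2) + rel_entropy \<nu> (gen_gauss 2)
    + ereal (1 / 2) * (1 - enn2ereal (moment 2 \<nu>))"
  unfolding legendre_def[of "Phi p"]
proof (rule SUP_least)
  fix t :: "real \<times> real \<times> real"
  interpret real_distribution \<nu> by fact
  have "moment 2 \<nu> < \<infinity>" using m by (simp add: le_less_trans)
  note i = moment_2_eq[OF \<nu> this]
  define M where "M = (\<integral>u. u\<^sup>2 \<partial>\<nu>)"
  have M: "0 \<le> M" "M \<le> 1" using i m by (auto simp: M_def ennreal_le_1)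
  have pen: "ereal (1 / 2) * (1 - enn2ereal (moment 2 \<nu>)) = ereal ((1 - M) / 2)"
    unfolding i(2) M_def[symmetric] using M by (simp add: enn2ereal_ennreal one_ereal_def)
  show "ereal (t \<bullet> (1, \<tau>1, \<tau>2)) - Phi p t \<le> legendre (Psi p \<nu>) (\<tau>1, \<tau>2) + rel_entropy \<nu> (gen_gauss 2)
    + ereal (1 / 2) * (1 - enn2ereal (moment 2 \<nu>))"
  proof (cases "t \<in> Phi_dom p")
    case False
    then show ?thesis by (simp add: Phi_infinite[OF p])
  next
    case True
    obtain t0 t1 t2 where t: "t = (t0, t1, t2)" by (cases t)
    have t0: "t0 < 1 / 2" and t2: "t2 < 1 / p" using True by (auto simp: t Phi_dom_def)
    obtain \<phi> where \<phi>: "Phi p t = ereal \<phi>"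
      "(\<integral>\<^sup>+ v. ennreal (exp (t \<bullet> stat p v)) \<partial>pair_gauss p) = ennreal (exp \<phi>)"
      by (rule Phi_finite[OF p True])
    define L where "L = (\<integral>u. lam p t2 (t1 * u) \<partial>\<nu>)"
    note [measurable] = measurable_lam[OF p]
    note il = integrable_lam[OF p t2 \<nu> i(1), of t1]
    have "(\<integral>\<^sup>+ z. ennreal (exp (t0 * z\<^sup>2 + lam p t2 (t1 * z) - \<phi>)) \<partial>gen_gauss 2)
      = (\<integral>\<^sup>+ z. ennreal (exp (t0 * z\<^sup>2 + lam p t2 (t1 * z))) * ennreal (exp (- \<phi>)) \<partial>gen_gauss 2)"
      by (simp add: ennreal_mult[symmetric] exp_add[symmetric])
    also have "\<dots> = ennreal (exp \<phi>) * ennreal (exp (- \<phi>))"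
      using \<phi>(2) unfolding t nn_integral_exp_stat_eq_lam[OF p t2] by (subst nn_integral_multc) auto
    also have "\<dots> = 1" by (simp add: ennreal_mult[symmetric] exp_add[symmetric])
    finally have "ereal (\<integral>z. t0 * z\<^sup>2 + lam p t2 (t1 * z) - \<phi> \<partial>\<nu>) \<le> rel_entropy \<nu> (gen_gauss 2)"
      using i il by (intro integral_le_rel_entropy \<nu> prob_space_gen_gauss_2) auto
    moreover have "prob UNIV = 1" using prob_space by simp
    ultimately have H: "ereal (t0 * M + L - \<phi>) \<le> rel_entropy \<nu> (gen_gauss 2)"
      using i il by (simp add: M_def L_def)
    have "ereal ((t1, t2) \<bullet> (\<tau>1, \<tau>2)) - Psi p \<nu> (t1, t2) \<le> legendre (Psi p \<nu>) (\<tau>1, \<tau>2)"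
      unfolding legendre_def by (rule SUP_upper) simp
    then have Q: "ereal (t1 * \<tau>1 + t2 * \<tau>2 - L) \<le> legendre (Psi p \<nu>) (\<tau>1, \<tau>2)"
      using t2 by (simp add: Psi_eq[OF p \<nu> i(1)] L_def)
    \<comment> \<open>The target has first coordinate 1 instead of \<open>M\<close>; the penalty
      covers the excess \<open>t0 * (1 - M)\<close>.\<close>
    have "(1 / 2 - t0) * (1 - M) \<ge> 0" using t0 M by (intro mult_nonneg_nonneg) auto
    then have "ereal (t \<bullet> (1, \<tau>1, \<tau>2)) - Phi p t \<le> ereal (t1 * \<tau>1 + t2 * \<tau>2 - L) + ereal (t0 * M + L - \<phi>) + ereal ((1 - M) / 2)"
      by (simp add: \<phi>(1)[unfolded t] t algebra_simps)
    also have "\<dots> \<le> legendre (Psi p \<nu>) (\<tau>1, \<tau>2) + rel_entropy \<nu> (gen_gauss 2) + ereal ((1 - M) / 2)"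
      by (intro add_mono Q H order_refl)
    finally show ?thesis unfolding pen .
  qed
qed

section \<open>Attainment\<close>

text \<open>The set where \<open>f\<close> is positive is open and null, hence empty.\<close>

lemma AE_lborel_le_zero_imp_le_zero:
  fixes f :: "'a::euclidean_space \<Rightarrow> real"
  assumes c: "continuous_on UNIV f" and ae: "AE x in lborel. f x \<le> 0"
  shows "f x \<le> 0"
proof -
  define S where "S = {x. f x > 0}"
  have o: "open S" unfolding S_def using c by (intro open_Collect_less continuous_on_const)
  have "S \<in> null_sets lborel"
    using ae o AE_iff_null_sets[of S lborel] by (auto simp: S_def not_less)
  then have "negligible S"
    by (simp add: negligible_iff_null_sets null_sets_completionI)
  then have "S = {}" using open_not_negligible[OF o] by blast
  then show ?thesis by (auto simp: S_def not_less)
qed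

text \<open>Both densities are positive everywhere, so null sets of the product are Lebesgue
  null.\<close>

lemma AE_pair_gauss_imp_AE_lborel:
  assumes p: "p \<ge> 2" and ae: "AE v in pair_gauss p. P v"
  shows "AE v in lborel. P v"
proof -
  interpret A: finite_measure "gen_gauss p" by (rule finite_gen_gauss) fact
  interpret B: prob_space "gen_gauss 2" by (rule prob_space_gen_gauss_2)
  have "pair_gauss p = density (lborel \<Otimes>\<^sub>M lborel)
    (\<lambda>(y, z). ennreal (gen_gauss_density p y) * ennreal (gen_gauss_density 2 z))"
    unfolding gen_gauss_def
    by (rule pair_measure_density)
       (auto simp: gen_gauss_def[symmetric] lborel.sigma_finite_measure_axioms B.sigma_finite_measure_axioms)
  also have "\<dots> = density lborel (\<lambda>(y, z). ennreal (gen_gauss_density p y) * ennreal (gen_gauss_density 2 z))"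
    by (simp add: lborel_prod)
  finally have eq: "pair_gauss p = \<dots>" .
  have "AE v in lborel. 0 < (\<lambda>(y, z). ennreal (gen_gauss_density p y) * ennreal (gen_gauss_density 2 z)) v \<longrightarrow> P v"
    using ae unfolding eq by (subst (asm) AE_density) (auto simp: lborel_prod[symmetric])
  then show ?thesis
    by (rule AE_mp) (use gen_gauss_density_pos[of p] gen_gauss_density_pos[of 2] p in \<open>auto simp: ennreal_zero_less_mult_iff\<close>)
qed

text \<open>By continuity and full support the inequality holds at every point; suitable points then
  isolate the coordinates of \<open>u\<close> one at a time.\<close>

lemma stat_separating:
  assumes p: "p \<ge> 2" and \<tau>2: "\<tau>2 > 0" and \<tau>1: "\<bar>\<tau>1\<bar> < \<tau>2 powr (1 / p)"
    and ae: "AE v in pair_gauss p. u \<bullet> (stat p v - (1, \<tau>1, \<tau>2)) \<le> 0"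
  shows "u = 0"
proof -
  obtain u0 u1 u2 where u: "u = (u0, u1, u2)" by (cases u)
  define s where "s = \<tau>2 powr (1 / p)"
  have s: "s > 0" "s powr p = \<tau>2" using \<tau>2 p by (auto simp: s_def powr_powr)
  have cont: "continuous_on UNIV (\<lambda>v. u \<bullet> (stat p v - (1, \<tau>1, \<tau>2)))"
    unfolding stat_def using p by (intro continuous_intros continuous_on_powr') auto
  have le: "u0 * (z\<^sup>2 - 1) + u1 * (z * y - \<tau>1) + u2 * (\<bar>y\<bar> powr p - \<tau>2) \<le> 0" for y z
    using AE_lborel_le_zero_imp_le_zero[OF cont AE_pair_gauss_imp_AE_lborel[OF p ae], of "(y, z)"]
    by (simp add: u stat_def algebra_simps)
  \<comment> \<open>For \<open>z = 1\<close> and \<open>\<bar>y\<bar> = s\<close> the terms with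
    \<open>u0\<close> and \<open>u2\<close> vanish, and the factors of \<open>u1\<close> at
    \<open>y = s\<close> and \<open>y = - s\<close> have opposite signs because
    \<open>\<bar>\<tau>1\<bar> < s\<close>.\<close>
  have "u1 * (s - \<tau>1) \<le> 0" using le[where z=1 and y=s] s by simp
  moreover have "u1 * (- s - \<tau>1) \<le> 0" using le[where z=1 and y="-s"] s by simp
  moreover have "s - \<tau>1 > 0" "- s - \<tau>1 < 0" using \<tau>1 by (auto simp: s_def)
  ultimately have u1: "u1 = 0"
    by (smt (verit, best) mult_pos_pos mult_neg_neg)
  \<comment> \<open>At \<open>y = 0\<close> and \<open>y = 2 powr (1 / p) * s\<close> the factor of
    \<open>u2\<close> is \<open>- \<tau>2\<close> and \<open>\<tau>2\<close>.\<close>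
  have "u2 * (- \<tau>2) \<le> 0" using le[where z=1 and y=0] u1 by simp
  moreover have "u2 * ((2 powr (1 / p) * s) powr p - \<tau>2) \<le> 0"
    using le[where z=1 and y="2 powr (1 / p) * s"] u1 s by simp
  then have "u2 * \<tau>2 \<le> 0" using s p by (simp add: powr_mult powr_powr)
  ultimately have u2: "u2 = 0" using \<tau>2 by (simp add: mult_le_0_iff zero_le_mult_iff)
  have "u0 = 0" using le[where z=0 and y=0] le[where z=2 and y=0] u1 u2 by simp
  then show ?thesis using u u1 u2 by (simp add: zero_prod_def)
qed

text \<open>The minimised integral is \<open>exp (Phi p t - t \<bullet> \<tau>)\<close> with
  \<open>\<tau> = (1, \<tau>1, \<tau>2)\<close>. Its value at 0 is finite, so the minimiser lies in
  the domain.\<close>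

lemma exists_Phi_maximiser:
  assumes p: "p \<ge> 2" and \<tau>2: "\<tau>2 > 0" and \<tau>1: "\<bar>\<tau>1\<bar> < \<tau>2 powr (1 / p)"
  obtains t where "t \<in> Phi_dom p"
    "\<And>h. (\<integral>\<^sup>+ v. ennreal (exp (t \<bullet> (stat p v - (1, \<tau>1, \<tau>2)))) \<partial>pair_gauss p)
      \<le> (\<integral>\<^sup>+ v. ennreal (exp ((t + h) \<bullet> (stat p v - (1, \<tau>1, \<tau>2)))) \<partial>pair_gauss p)"
proof -
  interpret A: finite_measure "gen_gauss p" by (rule finite_gen_gauss) fact
  interpret B: prob_space "gen_gauss 2" by (rule prob_space_gen_gauss_2)
  have fin: "finite_measure (pair_gauss p)"
    by (intro finite_measure_pair_measure A.finite_measure_axioms B.finite_measure_axioms)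
  interpret finite_measure "pair_gauss p" by (rule fin)
  let ?F = "\<lambda>t. \<integral>\<^sup>+ v. ennreal (exp (t \<bullet> (stat p v - (1, \<tau>1, \<tau>2)))) \<partial>pair_gauss p"
  have "\<exists>t. \<forall>s. ?F t \<le> ?F s"
    by (rule exp_integral_attains_min[OF fin]) (simp, use stat_separating[OF assms] in blast)
  then obtain t where t: "\<And>s. ?F t \<le> ?F s" by blast
  have "?F t \<le> ?F 0" by (rule t)
  also have "\<dots> < \<infinity>" using emeasure_finite[of "space (pair_gauss p)"] by (simp add: less_top[symmetric])
  finally have "?F t < \<infinity>" .
  moreover have "(\<integral>\<^sup>+ v. ennreal (exp (t \<bullet> stat p v)) \<partial>pair_gauss p) = ennreal (exp (t \<bullet> (1, \<tau>1, \<tau>2))) * ?F t"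
    by (subst nn_integral_cmult[symmetric])
       (auto simp: ennreal_mult[symmetric] exp_add[symmetric] inner_diff_right intro!: nn_integral_cong)
  ultimately have "(\<integral>\<^sup>+ v. ennreal (exp (t \<bullet> stat p v)) \<partial>pair_gauss p) < \<infinity>"
    by (simp add: ennreal_mult_less_top)
  then have "t \<in> Phi_dom p" using nn_integral_exp_stat_finite_iff[OF p] by simp
  then show ?thesis using that t by blast
qed

section \<open>The tilted measure and the minimising marginal\<close>

definition tilted :: "real \<Rightarrow> real \<times> real \<times> real \<Rightarrow> real \<Rightarrow> (real \<times> real) measure" where
  "tilted p t \<phi> = density (pair_gauss p) (\<lambda>v. ennreal (exp (t \<bullet> stat p v - \<phi>)))"

lemma sets_tilted[simp, measurable_cong]: "sets (tilted p t \<phi>) = sets (borel \<Otimes>\<^sub>M borel)"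
  by (simp add: tilted_def)

lemma nn_integral_tilted:
  assumes "f \<in> borel_measurable (borel \<Otimes>\<^sub>M borel)"
  shows "(\<integral>\<^sup>+ v. f v \<partial>tilted p t \<phi>) = (\<integral>\<^sup>+ v. ennreal (exp (t \<bullet> stat p v - \<phi>)) * f v \<partial>pair_gauss p)"
  unfolding tilted_def using assms by (subst nn_integral_density) simp_all

lemma tilted_marginal:
  assumes p: "p \<ge> 2" and t2: "t2 < 1 / p"
  shows "distr (tilted p (t0, t1, t2) \<phi>) borel snd
    = density (gen_gauss 2) (\<lambda>z. ennreal (exp (t0 * z\<^sup>2 + lam p t2 (t1 * z) - \<phi>)))" (is "?l = ?r")
proof (rule measure_eqI)
  note [measurable] = measurable_lam[OF p]
  show "sets ?l = sets ?r" by simp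
  fix B assume "B \<in> sets ?l"
  then have B[measurable]: "B \<in> sets borel" by simp
  have "emeasure ?l B = (\<integral>\<^sup>+ z. indicator B z \<partial>?l)" by simp
  also have "\<dots> = (\<integral>\<^sup>+ v. indicator B (snd v) \<partial>tilted p (t0, t1, t2) \<phi>)"
    by (rule nn_integral_distr) simp_all
  also have "\<dots> = (\<integral>\<^sup>+ v. ennreal (exp ((t0, t1, t2) \<bullet> stat p v - \<phi>)) * indicator B (snd v) \<partial>pair_gauss p)"
    by (rule nn_integral_tilted) simp
  also have "\<dots> = (\<integral>\<^sup>+ z. \<integral>\<^sup>+ y. ennreal (exp ((t0, t1, t2) \<bullet> stat p (y, z) - \<phi>)) * indicator B z \<partial>gen_gauss p \<partial>gen_gauss 2)"
    by (subst nn_integral_pair_gauss(2)[OF p]) simp_all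
  also have "\<dots> = (\<integral>\<^sup>+ z. ennreal (exp (t0 * z\<^sup>2 + lam p t2 (t1 * z) - \<phi>)) * indicator B z \<partial>gen_gauss 2)"
  proof (rule nn_integral_cong)
    fix z
    have "(\<integral>\<^sup>+ y. ennreal (exp ((t0, t1, t2) \<bullet> stat p (y, z) - \<phi>)) * indicator B z \<partial>gen_gauss p)
      = (\<integral>\<^sup>+ y. (ennreal (exp (t0 * z\<^sup>2 - \<phi>)) * indicator B z) * ennreal (exp ((t1 * z) * y + t2 * \<bar>y\<bar> powr p)) \<partial>gen_gauss p)"
      by (intro nn_integral_cong)
         (auto simp: inner_stat ennreal_mult[symmetric] exp_add[symmetric] algebra_simps indicator_def)
    also have "\<dots> = (ennreal (exp (t0 * z\<^sup>2 - \<phi>)) * indicator B z) * ennreal (exp (lam p t2 (t1 * z)))"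
      unfolding lam_bounds(1)[OF p t2] by (intro nn_integral_cmult) simp
    also have "\<dots> = ennreal (exp (t0 * z\<^sup>2 + lam p t2 (t1 * z) - \<phi>)) * indicator B z"
      by (auto simp: ennreal_mult[symmetric] exp_add[symmetric] algebra_simps indicator_def)
    finally show "(\<integral>\<^sup>+ y. ennreal (exp ((t0, t1, t2) \<bullet> stat p (y, z) - \<phi>)) * indicator B z \<partial>gen_gauss p) = \<dots>" .
  qed
  also have "\<dots> = emeasure ?r B" by (simp add: emeasure_density)
  finally show "emeasure ?l B = emeasure ?r B" .
qed

lemma rel_entropy_density:
  assumes "prob_space \<mu>" and [measurable]: "g \<in> borel_measurable \<mu>"
    and \<nu>: "\<nu> = density \<mu> (\<lambda>x. ennreal (exp (g x)))" and i: "integrable \<nu> g"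
  shows "rel_entropy \<nu> \<mu> = ereal (integral\<^sup>L \<nu> g)"
proof -
  interpret prob_space \<mu> by fact
  have ac: "absolutely_continuous \<mu> \<nu>" unfolding \<nu> by (rule absolutely_continuousI_density) simp
  have "AE x in \<mu>. ennreal (exp (g x)) = RN_deriv \<mu> \<nu> x"
    by (rule RN_deriv_unique) (simp_all add: \<nu>)
  then have "AE x in \<mu>. entropy_density (exp 1) \<mu> \<nu> x = g x"
  proof (rule AE_mp, intro AE_I2 impI)
    fix x assume "ennreal (exp (g x)) = RN_deriv \<mu> \<nu> x"
    then have "RN_deriv \<mu> \<nu> x = ennreal (exp (g x))" by simp
    then show "entropy_density (exp 1) \<mu> \<nu> x = g x" by (simp add: entropy_density_def log_def)
  qed
  then have "AE x in \<nu>. entropy_density (exp 1) \<mu> \<nu> x = g x"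
    unfolding \<nu> by (subst AE_density) (auto elim!: eventually_mono)
  then have "ereal_integral \<nu> (\<lambda>x. ereal (entropy_density (exp 1) \<mu> \<nu> x)) = ereal_integral \<nu> (\<lambda>x. ereal (g x))"
    unfolding ereal_integral_def
    by (intro arg_cong2[where f="(-)"] arg_cong[where f=enn2ereal] nn_integral_cong_AE) (auto elim!: eventually_mono)
  then show ?thesis using ac by (simp add: rel_entropy_def ereal_integral_eq_integral[OF i])
qed

text \<open>The minimising \<open>\<nu>\<close> is the marginal in \<open>z\<close> of the tilted pair measure at the maximising parameter.\<close>
lemma legendre_Phi_attained:
  assumes p: "p \<ge> 2" and \<tau>2: "\<tau>2 > 0" and \<tau>1: "\<bar>\<tau>1\<bar> < \<tau>2 powr (1 / p)"
  shows "\<exists>\<nu>. real_distribution \<nu> \<and> moment 2 \<nu> \<le> 1 \<and>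
    legendre (Psi p \<nu>) (\<tau>1, \<tau>2) + rel_entropy \<nu> (gen_gauss 2) + ereal (1 / 2) * (1 - enn2ereal (moment 2 \<nu>))
      \<le> legendre (Phi p) (1, \<tau>1, \<tau>2)"
proof -
  note [measurable] = measurable_lam[OF p]
  define \<tau> :: "real \<times> real \<times> real" where "\<tau> = (1, \<tau>1, \<tau>2)"
  obtain t where dom: "t \<in> Phi_dom p" and min: "\<And>h. (\<integral>\<^sup>+ v. ennreal (exp (t \<bullet> (stat p v - \<tau>))) \<partial>pair_gauss p)
      \<le> (\<integral>\<^sup>+ v. ennreal (exp ((t + h) \<bullet> (stat p v - \<tau>))) \<partial>pair_gauss p)"
    using exists_Phi_maximiser[OF assms] unfolding \<tau>_def by blast
  obtain \<phi> where \<phi>: "Phi p t = ereal \<phi>"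
      "(\<integral>\<^sup>+ v. ennreal (exp (t \<bullet> stat p v)) \<partial>pair_gauss p) = ennreal (exp \<phi>)"
    by (rule Phi_finite[OF p dom])
  obtain t0 t1 t2 where t: "t = (t0, t1, t2)" by (cases t)
  have t2: "t2 < 1 / p" using dom by (simp add: t Phi_dom_def)
  define P where "P = tilted p t \<phi>"
  have [measurable_cong]: "sets P = sets (borel \<Otimes>\<^sub>M borel)" by (simp add: P_def)
  have spP: "space P = UNIV" using sets_eq_imp_space_eq[OF \<open>sets P = _\<close>] by (simp add: space_pair_measure)
  \<comment> \<open>Two expressions for exponential moments under \<open>P\<close>: this one
    transfers the minimality of \<open>t\<close>, the next one the finiteness on
    \<open>Phi_dom\<close>.\<close>
  have shift: "(\<integral>\<^sup>+ v. ennreal (exp (h \<bullet> (stat p v - \<tau>))) \<partial>P)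
    = ennreal (exp (t \<bullet> \<tau> - \<phi>)) * (\<integral>\<^sup>+ v. ennreal (exp ((t + h) \<bullet> (stat p v - \<tau>))) \<partial>pair_gauss p)" for h
    unfolding P_def
    by (subst nn_integral_tilted, simp, subst nn_integral_cmult[symmetric], simp)
       (auto simp: ennreal_mult[symmetric] exp_add[symmetric] algebra_simps inner_simps intro!: nn_integral_cong)
  have shift': "(\<integral>\<^sup>+ v. ennreal (exp (h \<bullet> (stat p v - \<tau>))) \<partial>P)
    = ennreal (exp (- (h \<bullet> \<tau>) - \<phi>)) * (\<integral>\<^sup>+ v. ennreal (exp ((t + h) \<bullet> stat p v)) \<partial>pair_gauss p)" for h
    unfolding P_def
    by (subst nn_integral_tilted, simp, subst nn_integral_cmult[symmetric], simp)
       (auto simp: ennreal_mult[symmetric] exp_add[symmetric] algebra_simps inner_simps intro!: nn_integral_cong)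
  have "emeasure P (space P) = 1"
    using shift'[of 0] \<phi>(2) by (simp add: ennreal_mult[symmetric] exp_add[symmetric])
  then have "prob_space P" by (rule prob_spaceI)
  then interpret P: prob_space P .
  have crit: "integrable P (\<lambda>v. h \<bullet> (stat p v - \<tau>)) \<and> (\<integral>v. h \<bullet> (stat p v - \<tau>) \<partial>P) = 0" for h
  proof -
    obtain e where e: "e > 0" "ball t e \<subseteq> Phi_dom p"
      using open_Phi_dom dom by (meson open_contains_ball)
    \<comment> \<open>The domain is open, so a short multiple of \<open>h\<close> may be added to or
      subtracted from \<open>t\<close>; this makes both exponential moments in the first-order
      condition finite. Linearity then removes the factor \<open>d\<close>.\<close>
    define d where "d = e / (2 * (norm h + 1))"
    have d: "d > 0" using e by (simp add: d_def add_nonneg_pos)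
    have "norm (d *\<^sub>R h) < e"
    proof -
      have "norm (d *\<^sub>R h) = d * norm h" using d by simp
      also have "\<dots> < d * (2 * (norm h + 1))" using d by (intro mult_strict_left_mono) (auto simp: add_nonneg_pos)
      also have "\<dots> = e"
      proof -
        have "norm h + 1 > 0" by (simp add: add_nonneg_pos)
        then show ?thesis by (simp add: d_def)
      qed
      finally show ?thesis .
    qed
    then have tdom: "t + d *\<^sub>R h \<in> Phi_dom p" "t + - (d *\<^sub>R h) \<in> Phi_dom p"
      by (intro subsetD[OF e(2)]; simp add: dist_norm)+
    have fin: "(\<integral>\<^sup>+ v. ennreal (exp (k \<bullet> (stat p v - \<tau>))) \<partial>P) < \<infinity>" if "t + k \<in> Phi_dom p" for k
      using that nn_integral_exp_stat_finite_iff[OF p, of "t + k"] unfolding shift'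
      by (simp add: ennreal_mult_less_top)
    let ?f = "\<lambda>v. (d *\<^sub>R h) \<bullet> (stat p v - \<tau>)"
    have f: "integrable P ?f" "integral\<^sup>L P ?f = 0"
    proof (rule_tac [!] integral_eq_0_of_exp_min[where M=P and f="?f"])
      show "finite_measure P" "finite_measure P" by unfold_locales
      show "?f \<in> borel_measurable P" "?f \<in> borel_measurable P" by measurable
      show "(\<integral>\<^sup>+ v. ennreal (exp (?f v)) \<partial>P) < \<infinity>" "(\<integral>\<^sup>+ v. ennreal (exp (?f v)) \<partial>P) < \<infinity>"
        by (rule fin[OF tdom(1)])+
      show "(\<integral>\<^sup>+ v. ennreal (exp (- ?f v)) \<partial>P) < \<infinity>" "(\<integral>\<^sup>+ v. ennreal (exp (- ?f v)) \<partial>P) < \<infinity>"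
        using fin[OF tdom(2)] by (simp_all add: inner_minus_left)
      have m: "emeasure P (space P) \<le> (\<integral>\<^sup>+ v. ennreal (exp (s * ?f v)) \<partial>P)" for s
      proof -
        have "emeasure P (space P) = (\<integral>\<^sup>+ v. ennreal (exp (0 \<bullet> (stat p v - \<tau>))) \<partial>P)" by simp
        also have "\<dots> \<le> (\<integral>\<^sup>+ v. ennreal (exp ((s *\<^sub>R (d *\<^sub>R h)) \<bullet> (stat p v - \<tau>))) \<partial>P)"
          unfolding shift using min[of "s *\<^sub>R (d *\<^sub>R h)"] by (simp add: mult_left_mono)
        finally show ?thesis by (simp add: mult.assoc)
      qed
      show "emeasure P (space P) \<le> (\<integral>\<^sup>+ v. ennreal (exp (s * ?f v)) \<partial>P)"
        "emeasure P (space P) \<le> (\<integral>\<^sup>+ v. ennreal (exp (s * ?f v)) \<partial>P)" for s by (rule m)+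
    qed
    then show ?thesis using d by (simp add: inner_scaleR_left)
  qed
  have mean: "integrable P (\<lambda>v. h \<bullet> stat p v)" "(\<integral>v. h \<bullet> stat p v \<partial>P) = h \<bullet> \<tau>" for h
  proof -
    have *: "h \<bullet> stat p v = h \<bullet> (stat p v - \<tau>) + h \<bullet> \<tau>" for v by (simp add: inner_diff_right)
    show "integrable P (\<lambda>v. h \<bullet> stat p v)"
      unfolding * using crit[of h] by (intro Bochner_Integration.integrable_add) auto
    show "(\<integral>v. h \<bullet> stat p v \<partial>P) = h \<bullet> \<tau>"
      unfolding * using crit[of h] by (subst Bochner_Integration.integral_add) (auto simp: P.prob_space)
  qed
  define \<nu> where "\<nu> = distr P borel snd"
  have snd_m[measurable]: "snd \<in> P \<rightarrow>\<^sub>M (borel :: real measure)" by measurable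
  have rd: "real_distribution \<nu>"
    unfolding \<nu>_def by (rule P.real_distribution_distr) simp
  interpret N: real_distribution \<nu> by (rule rd)
  have \<nu>_dens: "\<nu> = density (gen_gauss 2) (\<lambda>z. ennreal (exp (t0 * z\<^sup>2 + lam p t2 (t1 * z) - \<phi>)))"
    unfolding \<nu>_def P_def t by (rule tilted_marginal[OF p t2])
  have sq: "integrable \<nu> (\<lambda>u. u\<^sup>2)" "(\<integral>u. u\<^sup>2 \<partial>\<nu>) = 1"
  proof -
    \<comment> \<open>This vector reads off the first coordinate of the mean \<open>\<tau>\<close>,
      which is 1.\<close>
    have "(1, 0, 0) \<bullet> stat p v = (snd v)\<^sup>2" for v by (simp add: stat_def)
    then show "integrable \<nu> (\<lambda>u. u\<^sup>2)" "(\<integral>u. u\<^sup>2 \<partial>\<nu>) = 1"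
      using mean[of "(1, 0, 0)"] unfolding \<nu>_def
      by (auto simp: integrable_distr_eq integral_distr \<tau>_def)
  qed
  have mom: "moment 2 \<nu> = 1"
    unfolding moment_def abs_powr_2 using nn_integral_eq_integral[OF sq(1)] sq(2) by simp
  define L where "L s1 s2 = (\<integral>u. lam p s2 (s1 * u) \<partial>\<nu>)" for s1 s2
  have H: "rel_entropy \<nu> (gen_gauss 2) = ereal (t0 + L t1 t2 - \<phi>)"
  proof -
    note il = integrable_lam[OF p t2 rd sq(1), of t1]
    have "rel_entropy \<nu> (gen_gauss 2) = ereal (\<integral>z. t0 * z\<^sup>2 + lam p t2 (t1 * z) - \<phi> \<partial>\<nu>)"
      using sq il by (intro rel_entropy_density prob_space_gen_gauss_2 \<nu>_dens) auto
    moreover have "N.prob UNIV = 1" using N.prob_space by simp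
    ultimately show ?thesis using sq il by (simp add: L_def)
  qed
  have Leg: "legendre (Psi p \<nu>) (\<tau>1, \<tau>2) \<le> ereal (t1 * \<tau>1 + t2 * \<tau>2 - L t1 t2)"
    unfolding legendre_def
  proof (rule SUP_least)
    fix s :: "real \<times> real"
    obtain s1 s2 where s: "s = (s1, s2)" by (cases s)
    show "ereal (s \<bullet> (\<tau>1, \<tau>2)) - Psi p \<nu> s \<le> ereal (t1 * \<tau>1 + t2 * \<tau>2 - L t1 t2)"
    proof (cases "s2 < 1 / p")
      case False
      then show ?thesis by (simp add: s Psi_eq[OF p rd sq(1)])
    next
      case s2: True
      \<comment> \<open>\<open>exp D\<close> normalises the change of tilt from \<open>(t1, t2)\<close> to \<open>(s1, s2)\<close> conditionally on \<open>z\<close>,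
        so \<open>exp f\<close> has mean one and Jensen's inequality applies.\<close>
      define D where "D z = lam p s2 (s1 * z) - lam p t2 (t1 * z)" for z
      define f where "f v = (0, s1 - t1, s2 - t2) \<bullet> stat p v - D (snd v)" for v
      have [measurable]: "D \<in> borel_measurable borel" unfolding D_def[abs_def] by measurable
      have D: "integrable \<nu> D" "integral\<^sup>L \<nu> D = L s1 s2 - L t1 t2"
        unfolding D_def[abs_def] L_def
        using integrable_lam[OF p s2 rd sq(1)] integrable_lam[OF p t2 rd sq(1)] by auto
      have DP: "integrable P (\<lambda>v. D (snd v))" "(\<integral>v. D (snd v) \<partial>P) = L s1 s2 - L t1 t2"
        using D unfolding \<nu>_def by (auto simp: integrable_distr_eq integral_distr)
      have "(\<integral>\<^sup>+ v. ennreal (exp (f v)) \<partial>P)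
        = (\<integral>\<^sup>+ v. ennreal (exp ((t0, s1, s2) \<bullet> stat p v - \<phi>)) * ennreal (exp (- D (snd v))) \<partial>pair_gauss p)"
        unfolding P_def f_def
        by (subst nn_integral_tilted)
           (auto simp: t stat_def ennreal_mult[symmetric] exp_add[symmetric] algebra_simps intro!: nn_integral_cong)
      \<comment> \<open>\<open>\<phi>\<close> belongs to the tilt by \<open>t\<close>, so the tilt
        by \<open>(t0, s1, s2)\<close> need not have mass one here; \<open>exp (- D)\<close> turns
        its marginal density into that of \<open>\<nu>\<close>.\<close>
      also have "\<dots> = (\<integral>\<^sup>+ v. ennreal (exp (- D (snd v))) \<partial>tilted p (t0, s1, s2) \<phi>)"
        by (subst nn_integral_tilted) auto
      also have "\<dots> = (\<integral>\<^sup>+ z. ennreal (exp (- D z)) \<partial>distr (tilted p (t0, s1, s2) \<phi>) borel snd)"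
        by (subst nn_integral_distr) auto
      also have "\<dots> = (\<integral>\<^sup>+ z. ennreal (exp (t0 * z\<^sup>2 + lam p s2 (s1 * z) - \<phi>)) * ennreal (exp (- D z)) \<partial>gen_gauss 2)"
        unfolding tilted_marginal[OF p s2] by (subst nn_integral_density) auto
      also have "\<dots> = (\<integral>\<^sup>+ z. ennreal (exp (t0 * z\<^sup>2 + lam p t2 (t1 * z) - \<phi>)) \<partial>gen_gauss 2)"
        by (simp add: D_def ennreal_mult[symmetric] exp_add[symmetric] add_diff_eq)
      also have "\<dots> = emeasure \<nu> (space \<nu>)"
        unfolding \<nu>_dens by (simp add: emeasure_density)
      also have "\<dots> = 1" by (rule N.emeasure_space_1)
      finally have "integral\<^sup>L P f \<le> 0"
        using mean(1) DP(1) by (intro integral_nonpos_of_exp P.prob_space_axioms) (auto simp: f_def[abs_def])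
      moreover have "integral\<^sup>L P f = (s1 - t1) * \<tau>1 + (s2 - t2) * \<tau>2 - (L s1 s2 - L t1 t2)"
        unfolding f_def[abs_def] using mean DP by (subst Bochner_Integration.integral_diff) (auto simp: \<tau>_def)
      moreover have "Psi p \<nu> s = ereal (L s1 s2)"
        using s2 by (simp add: s Psi_eq[OF p rd sq(1)] L_def)
      ultimately show ?thesis by (simp add: s algebra_simps)
    qed
  qed
  \<comment> \<open>The terms \<open>L t1 t2\<close> of the quenched transform and of the entropy
    cancel, and the penalty is 0.\<close>
  have "legendre (Psi p \<nu>) (\<tau>1, \<tau>2) + rel_entropy \<nu> (gen_gauss 2) + ereal (1 / 2) * (1 - enn2ereal (moment 2 \<nu>))
    \<le> ereal (t1 * \<tau>1 + t2 * \<tau>2 - L t1 t2) + ereal (t0 + L t1 t2 - \<phi>) + 0"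
    unfolding H mom by (intro add_mono Leg order_refl) (simp add: one_ennreal.rep_eq)
  also have "\<dots> = ereal (t \<bullet> (1, \<tau>1, \<tau>2)) - Phi p t" by (simp add: \<phi>(1) t[symmetric]) (simp add: t)
  also have "\<dots> \<le> legendre (Phi p) (1, \<tau>1, \<tau>2)" unfolding legendre_def by (rule SUP_upper) simp
  finally show ?thesis using rd mom by (intro exI[of _ \<nu>]) auto
qed

section \<open>Proof of the variational formula\<close>

lemma le_Inf_add_ereal:
  fixes a c :: ereal
  assumes "\<And>x. x \<in> S \<Longrightarrow> a \<le> x + c" "0 \<le> c"
  shows "a \<le> Inf S + c"
\<comment> \<open>Subtraction of \<open>c\<close> is safe for finite \<open>c\<close>. If
  \<open>c = \<infinity>\<close> the right side is \<open>\<infinity>\<close> even when the infimum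
  is \<open>- \<infinity>\<close>, by the convention for \<open>ereal\<close> addition;
  \<open>0 \<le> c\<close> excludes \<open>c = - \<infinity>\<close>.\<close>
proof (cases c)
  case (real r)
  have "a - ereal r \<le> Inf S"
    by (rule Inf_greatest) (use assms(1) real in \<open>simp add: ereal_minus_le\<close>)
  then show ?thesis using real by (simp add: ereal_minus_le)
qed (use assms in auto)

theorem theorem2p7:
  fixes p :: real
  assumes "p \<ge> 2"
  shows "(\<forall>w::real. I_annealed p w =
            (INF \<nu>\<in>{\<nu> :: real measure. real_distribution \<nu> \<and> moment 2 \<nu> \<le> 1}.
               I_quenched p \<nu> w + rel_entropy \<nu> (gen_gauss 2)
                 + ereal (1 / 2) * (1 - enn2ereal (moment 2 \<nu>))))
       \<and> (\<forall>w::real. I_annealed p w \<le> I_quenched p (gen_gauss 2) w)"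
proof -
  note p = assms
  let ?pen = "\<lambda>\<nu>. ereal (1 / 2) * (1 - enn2ereal (moment 2 \<nu>))"
  let ?R = "\<lambda>\<nu> w. I_quenched p \<nu> w + rel_entropy \<nu> (gen_gauss 2) + ?pen \<nu>"
  have upper: "I_annealed p w \<le> ?R \<nu> w" if \<nu>: "real_distribution \<nu>" "moment 2 \<nu> \<le> 1" for \<nu> w
  proof -
    \<comment> \<open>The Gibbs inequality for the zero function makes the entropy
      nonnegative.\<close>
    have "ereal (\<integral>x. 0 \<partial>\<nu>) \<le> rel_entropy \<nu> (gen_gauss 2)"
      using prob_space.emeasure_space_1[OF prob_space_gen_gauss_2]
      by (intro integral_le_rel_entropy \<nu> prob_space_gen_gauss_2) auto
    then have H: "rel_entropy \<nu> (gen_gauss 2) \<ge> 0" by (simp add: zero_ereal_def)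
    have P: "?pen \<nu> \<ge> 0"
    proof -
      have "enn2ereal (moment 2 \<nu>) \<le> 1" using \<nu>(2) by (simp add: less_eq_ennreal.rep_eq one_ennreal.rep_eq)
      then show ?thesis by (intro ereal_0_le_mult) (auto simp: ereal_diff_positive)
    qed
    have "I_annealed p w \<le> x + (rel_entropy \<nu> (gen_gauss 2) + ?pen \<nu>)"
      if x_in: "x \<in> {legendre (Psi p \<nu>) (\<tau>1, \<tau>2) | \<tau>1 \<tau>2. \<tau>2 > 0 \<and> \<tau>1 * \<tau>2 powr (- 1 / p) = w}" for x
    proof -
      obtain \<tau>1 \<tau>2 where x: "x = legendre (Psi p \<nu>) (\<tau>1, \<tau>2)" "\<tau>2 > 0" "\<tau>1 * \<tau>2 powr (- 1 / p) = w"
        using x_in by blast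
      have "I_annealed p w \<le> legendre (Phi p) (1, \<tau>1, \<tau>2)"
        unfolding I_annealed_def using x
        by (intro Inf_lower CollectI exI[of _ 1] exI[of _ \<tau>1] exI[of _ \<tau>2]) auto
      also have "\<dots> \<le> x + rel_entropy \<nu> (gen_gauss 2) + ?pen \<nu>"
        unfolding x(1) by (rule legendre_Phi_le[OF p \<nu>])
      finally show ?thesis by (simp add: add.assoc)
    qed
    then have "I_annealed p w \<le> I_quenched p \<nu> w + (rel_entropy \<nu> (gen_gauss 2) + ?pen \<nu>)"
      unfolding I_quenched_def by (rule le_Inf_add_ereal[OF _ add_nonneg_nonneg[OF H P]])
    then show ?thesis by (simp add: add.assoc)
  qed
  have lower: "(INF \<nu>\<in>{\<nu>. real_distribution \<nu> \<and> moment 2 \<nu> \<le> 1}. ?R \<nu> w) \<le> I_annealed p w" for w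
    unfolding I_annealed_def
  proof (rule Inf_greatest)
    fix x assume "x \<in> {legendre (Phi p) (\<tau>0, \<tau>1, \<tau>2) |\<tau>0 \<tau>1 \<tau>2.
       \<tau>0 > 0 \<and> \<tau>2 > 0 \<and> \<tau>0 powr (- 1 / 2) * \<tau>1 * \<tau>2 powr (- 1 / p) = w}"
    then obtain \<tau>0 \<tau>1 \<tau>2 where x: "x = legendre (Phi p) (\<tau>0, \<tau>1, \<tau>2)" and \<tau>: "\<tau>0 > 0" "\<tau>2 > 0"
      and w: "\<tau>0 powr (- 1 / 2) * \<tau>1 * \<tau>2 powr (- 1 / p) = w" by blast
    \<comment> \<open>Normalising the first coordinate to 1 moves \<open>\<tau>0\<close> into
      \<open>\<sigma>\<close>, which preserves the constraint given by \<open>w\<close>.\<close>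
    define \<sigma> where "\<sigma> = \<tau>1 / sqrt \<tau>0"
    have w': "\<sigma> * \<tau>2 powr (- 1 / p) = w"
      using w \<tau> by (simp add: \<sigma>_def powr_minus_divide powr_half_sqrt)
    have le: "legendre (Phi p) (1, \<sigma>, \<tau>2) \<le> x" unfolding x \<sigma>_def by (rule legendre_Phi_scale[OF p \<tau>(1)])
    show "(INF \<nu>\<in>{\<nu>. real_distribution \<nu> \<and> moment 2 \<nu> \<le> 1}. ?R \<nu> w) \<le> x"
    proof (cases "\<bar>\<sigma>\<bar> < \<tau>2 powr (1 / p)")
      case True
      obtain \<nu> where \<nu>: "real_distribution \<nu>" "moment 2 \<nu> \<le> 1"
        "legendre (Psi p \<nu>) (\<sigma>, \<tau>2) + rel_entropy \<nu> (gen_gauss 2) + ?pen \<nu> \<le> legendre (Phi p) (1, \<sigma>, \<tau>2)"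
        using legendre_Phi_attained[OF p \<tau>(2) True] by blast
      have "(INF \<nu>\<in>{\<nu>. real_distribution \<nu> \<and> moment 2 \<nu> \<le> 1}. ?R \<nu> w) \<le> ?R \<nu> w"
        using \<nu> by (intro INF_lower) auto
      also have "\<dots> \<le> legendre (Psi p \<nu>) (\<sigma>, \<tau>2) + rel_entropy \<nu> (gen_gauss 2) + ?pen \<nu>"
        unfolding I_quenched_def using w' \<tau>(2) by (intro add_mono order_refl Inf_lower) blast
      finally show ?thesis using \<nu>(3) le by (meson order_trans)
    next
      case False
      then have "x = \<infinity>" using legendre_Phi_eq_infinity[OF p \<tau>(2), of \<sigma>] le by (simp add: not_less)
      then show ?thesis by simp
    qed
  qed
  \<comment> \<open>For the comparison with the standard Gaussian: its entropy relative to itself is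
    0, and its second moment one makes the penalty vanish.\<close>
  have gauss: "?R (gen_gauss 2) w = I_quenched p (gen_gauss 2) w \<and> real_distribution (gen_gauss 2) \<and> moment 2 (gen_gauss 2) \<le> 1" for w
  proof -
    interpret prob_space "gen_gauss 2" by (rule prob_space_gen_gauss_2)
    have rd: "real_distribution (gen_gauss 2)" by unfold_locales simp
    have "has_bochner_integral lborel (\<lambda>x. std_normal_density x * x ^ (2 * 1)) (fact (2 * 1) / (2^1 * fact 1))"
      by (rule std_normal_moment_even)
    then have b: "integrable lborel (\<lambda>x. std_normal_density x * x\<^sup>2)" "(\<integral>x. std_normal_density x * x\<^sup>2 \<partial>lborel) = 1"
      by (auto simp: has_bochner_integral_iff)
    have "moment 2 (gen_gauss 2) = (\<integral>\<^sup>+ x. ennreal (std_normal_density x * x\<^sup>2) \<partial>lborel)"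
      unfolding moment_def gen_gauss_2_eq abs_powr_2 by (subst nn_integral_density) (auto simp: ennreal_mult)
    also have "\<dots> = 1" using b by (subst nn_integral_eq_integral) auto
    finally have m: "moment 2 (gen_gauss 2) = 1" .
    have "rel_entropy (gen_gauss 2) (gen_gauss 2) = ereal (\<integral>x. 0 \<partial>gen_gauss 2)"
      by (rule rel_entropy_density[OF prob_space_gen_gauss_2]) (auto simp: density_1)
    then show ?thesis using rd m by (simp add: one_ennreal.rep_eq)
  qed
  show ?thesis
  proof (intro conjI allI antisym)
    fix w
    show "I_annealed p w \<le> (INF \<nu>\<in>{\<nu>. real_distribution \<nu> \<and> moment 2 \<nu> \<le> 1}. ?R \<nu> w)"
      by (rule INF_greatest) (use upper in auto)
    show "(INF \<nu>\<in>{\<nu>. real_distribution \<nu> \<and> moment 2 \<nu> \<le> 1}. ?R \<nu> w) \<le> I_annealed p w" by (rule lower)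
    show "I_annealed p w \<le> I_quenched p (gen_gauss 2) w" using upper[of "gen_gauss 2" w] gauss[of w] by simp
  qed
qed

end
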